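(* Every claw-pivot-minor-free graph has linear rank-width at most $59$.
   Context: All graphs are finite, without loops or multiple edges. The claw is the star $K_{1,3}$ on four vertices. The local complementation at a vertex $u$ of $G$ replaces every edge of the subgraph induced by the neighbours of $u$ with a non-edge, and vice versa; the result is denoted $G*u$. Pivoting an edge $uv$ of $G$ gives $G\wedge uv = G*u*v*u$. A graph $H$ is a pivot-minor of $G$ if $H$ can be obtained from $G$ by a sequence of edge pivots and vertex deletions. A graph is $H$-pivot-minor-free if it has no pivot-minor isomorphic to $H$. For a graph $G$ with adjacency matrix $A_G$ and $X\subseteq V(G)$, let $\mathrm{cutrk}_G(X)$ be the rank over the binary field of the submatrix $A_G[X,V(G)\setminus X]$ with rows $X$ and columns $V(G)\setminus X$. The width of a linear ordering $(x_1,\ldots,x_n)$ of $V(G)$ is $\max_{1\le i\le n}\mathrm{cutrk}_G(\{x_1,\ldots,x_i\})$. The linear rank-width of $G$ is the minimum width over all linear orderings of $V(G)$. *)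

theory Defs
  imports
    "Graph_Theory.Graph_Theory"
    "HOL-Combinatorics.Multiset_Permutations"
    "HOL-Library.Function_Algebras"
    "HOL-Library.Z2"
begin

text \<open>
  A finite graph without loops or multiple edges is a record satisfying \<^locale>\<open>pair_graph\<close>:
  a finite vertex set together with an irreflexive symmetric arc relation on it, so that the
  edge \<open>uv\<close> is represented by the two arcs \<open>(u, v)\<close> and \<open>(v, u)\<close>.
\<close>

definition nbrs :: "'a pair_pre_digraph \<Rightarrow> 'a \<Rightarrow> 'a set" where
  "nbrs G u = {v. (u, v) \<in> parcs G}"

definition local_complement :: "'a pair_pre_digraph \<Rightarrow> 'a \<Rightarrow> 'a pair_pre_digraph" where
  "local_complement G u =
     (let P = {(x, y). x \<in> nbrs G u \<and> y \<in> nbrs G u \<and> x \<noteq> y}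
      in \<lparr>pverts = pverts G, parcs = (parcs G - P) \<union> (P - parcs G)\<rparr>)"

definition pivot :: "'a pair_pre_digraph \<Rightarrow> 'a \<Rightarrow> 'a \<Rightarrow> 'a pair_pre_digraph" where
  "pivot G u v = local_complement (local_complement (local_complement G u) v) u"

definition delete_vertex :: "'a pair_pre_digraph \<Rightarrow> 'a \<Rightarrow> 'a pair_pre_digraph" where
  "delete_vertex G v =
     \<lparr>pverts = pverts G - {v}, parcs = {(x, y) \<in> parcs G. x \<noteq> v \<and> y \<noteq> v}\<rparr>"

lemma with_proj_delete_vertex:
  "with_proj (delete_vertex G v) = pre_digraph.del_vert (with_proj G) v"
  by (auto simp: delete_vertex_def with_proj_def pre_digraph.del_vert_def)

text \<open>\<open>pivot_minor G H\<close>: the graph \<open>H\<close> is a pivot-minor of \<open>G\<close>.\<close>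

inductive pivot_minor :: "'a pair_pre_digraph \<Rightarrow> 'a pair_pre_digraph \<Rightarrow> bool"
  for G :: "'a pair_pre_digraph" where
  refl: "pivot_minor G G"
| pivot: "pivot_minor G H \<Longrightarrow> (u, v) \<in> parcs H \<Longrightarrow> pivot_minor G (pivot H u v)"
| delete: "pivot_minor G H \<Longrightarrow> v \<in> pverts H \<Longrightarrow> pivot_minor G (delete_vertex H v)"

definition pivot_minor_free :: "'a pair_pre_digraph \<Rightarrow> 'b pair_pre_digraph \<Rightarrow> bool" where
  "pivot_minor_free G H \<longleftrightarrow>
     \<not> (\<exists>G'. pivot_minor G G' \<and> digraph_iso (with_proj G') (with_proj H))"

definition claw :: "nat pair_pre_digraph" where
  "claw = \<lparr>pverts = {0, 1, 2, 3}, parcs = {0} \<times> {1, 2, 3} \<union> {1, 2, 3} \<times> {0}\<rparr>"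

lemma claw_is_K_1_3: "complete_bipartite_digraph 1 3 (with_proj claw)"
  unfolding complete_bipartite_digraph_pair_def
proof (intro conjI exI)
  show "finite (pverts claw)" "pverts claw = {0} \<union> {1, 2, 3}"
    "parcs claw = {0} \<times> {1, 2, 3} \<union> {1, 2, 3} \<times> {0}"
    by (simp_all add: claw_def insert_commute)
qed simp_all

lemma pair_graph_claw: "pair_graph claw"
  using claw_is_K_1_3 by (rule pair_graphI_complete_bipartite)

lemma pair_graph_local_complement:
  assumes "pair_graph G"
  shows "pair_graph (local_complement G u)"
proof -
  interpret pair_graph G by fact
  let ?H = "local_complement G u"
  have sub: "parcs ?H \<subseteq> pverts G \<times> pverts G"
    by (auto simp: local_complement_def nbrs_def Let_def dest: in_arcsD1 in_arcsD2)
  have [simp]: "pverts ?H = pverts G"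
    by (simp add: local_complement_def Let_def)
  have fin: "finite (parcs ?H)"
    using sub pair_finite_verts by (meson finite_SigmaI finite_subset)
  have sym: "sym (parcs ?H)"
    by (rule symI) (auto simp: local_complement_def Let_def dest: arcs_symmetric)
  have irr: "fst e \<noteq> snd e" if "e \<in> parcs ?H" for e
    using that by (cases e) (auto simp: local_complement_def Let_def dest: no_loops')
  show ?thesis
    using sub fin sym irr pair_finite_verts
    by unfold_locales (auto simp: symmetric_def)
qed

lemma pair_graph_delete_vertex:
  assumes "pair_graph G"
  shows "pair_graph (delete_vertex G v)"
proof -
  interpret pair_graph G by fact
  have fin: "finite (parcs (delete_vertex G v))"
    by (rule finite_subset[OF _ pair_finite_arcs]) (auto simp: delete_vertex_def)
  have sym: "sym (parcs (delete_vertex G v))"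
    by (rule symI) (auto simp: delete_vertex_def dest: arcs_symmetric)
  show ?thesis
    using fin sym pair_finite_verts
    by unfold_locales
      (auto simp: delete_vertex_def symmetric_def dest: in_arcsD1 in_arcsD2 no_loops')
qed

lemma pair_graph_pivot_minor:
  assumes "pivot_minor G H" "pair_graph G"
  shows "pair_graph H"
  using assms
  by induction (auto simp: pivot_def intro: pair_graph_local_complement pair_graph_delete_vertex)

text \<open>The vector space of functions \<open>'a \<Rightarrow> bit\<close> over the binary field \<^typ>\<open>bit\<close>.\<close>

interpretation bit_fun: vector_space "\<lambda>(c :: bit) (f :: 'a \<Rightarrow> bit) x. c * f x"
  by (rule vector_space.intro)
    (simp_all only: fun_eq_iff plus_fun_apply distrib_left distrib_right mult.assoc mult_1_left simp_thms)

text \<open>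
  The rank (dimension of the row space) of the submatrix of \<open>M\<close> with rows \<open>R\<close> and columns \<open>C\<close>.
  Each row is extended by zero outside \<open>C\<close>, which embeds the binary vectors indexed by \<open>C\<close> into
  \<open>'c \<Rightarrow> bit\<close>.
\<close>

definition bit_rank :: "('r \<Rightarrow> 'c \<Rightarrow> bit) \<Rightarrow> 'r set \<Rightarrow> 'c set \<Rightarrow> nat" where
  "bit_rank M R C = bit_fun.dim ((\<lambda>r c. if c \<in> C then M r c else 0) ` R)"

definition adj_matrix :: "'a pair_pre_digraph \<Rightarrow> 'a \<Rightarrow> 'a \<Rightarrow> bit" where
  "adj_matrix G x y = (if (x, y) \<in> parcs G then 1 else 0)"

definition cutrk :: "'a pair_pre_digraph \<Rightarrow> 'a set \<Rightarrow> nat" where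
  "cutrk G X = bit_rank (adj_matrix G) X (pverts G - X)"

text \<open>
  A linear ordering of the vertex set is a repetition-free list of its elements. Inserting \<open>0\<close>
  only matters for the graph without vertices, whose width is thereby \<open>0\<close>.
\<close>

definition ordering_width :: "'a pair_pre_digraph \<Rightarrow> 'a list \<Rightarrow> nat" where
  "ordering_width G xs = Max (insert 0 ((\<lambda>i. cutrk G (set (take i xs))) ` {1..length xs}))"

definition linear_rank_width :: "'a pair_pre_digraph \<Rightarrow> nat" where
  "linear_rank_width G = Min (ordering_width G ` permutations_of_set (pverts G))"

end

theory Submission
  imports Defs
begin

text \<open>
  Pivoting does not change cut-ranks, so the graph may be replaced by any pivot-equivalent one, and
  components can be treated separately. A connected graph without an induced claw, bull or path on
  five vertices has no independent set of size three; as \<open>P\<^sub>5\<close> and the bull pivot to graphs with a claw,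
  this applies to every graph in the pivot class, which in turn excludes the wheel \<open>W\<^sub>4\<close>.
  Choose two cliques in some pivot-equivalent graph that cover as many vertices as possible. If a
  vertex \<open>x\<close> is left over, at most two pivots yield two cliques that cover \<open>x\<close> as well. So the
  vertex set is the union of two cliques \<open>P\<close> and \<open>Q\<close>. Since \<open>W\<^sub>4\<close> is excluded, the bipartite graph
  between them has no induced path on five vertices, hence its components are chain graphs. Listing
  the components one after the other, each in its chain order, gives cuts of rank at most three.
\<close>

text \<open>The obstacle is that a graph without three independent vertices need not be covered by
  two cliques: the five-cycle is not, and becomes so only after a pivot. This is why the cliques are
  sought in the whole pivot class, and why independent triples are excluded in the whole class and
  not just in the given graph. The stronger form yields the main tool: a pivot on an edge between
  the hub and the rim of W4 (a four-cycle and a further vertex adjacent to all of it) leaves three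
  independent vertices. Between two cliques, two disjoint edges without cross edges span a
  four-cycle, so a vertex adjacent to all four ends is a hub. Most contradictions about two cliques
  arise in this way, and they make neighbourhoods nested wherever such a hub exists. The rank three
  is one for each clique and one for the edges between them, which the ordering confines to a single
  rectangle; this is far below 59.\<close>

definition sgraph :: "('a \<Rightarrow> 'a \<Rightarrow> bool) \<Rightarrow> bool" where
  "sgraph g \<longleftrightarrow> (\<forall>a b. g a b \<longrightarrow> g b a) \<and> (\<forall>a. \<not> g a a)"

lemma sgraph_sym: "sgraph g \<Longrightarrow> g a b \<longleftrightarrow> g b a"
  and sgraph_irrefl: "sgraph g \<Longrightarrow> \<not> g a a"
  by (auto simp: sgraph_def)

section \<open>Local complementation and pivoting on adjacency relations\<close>

definition lc :: "('a \<Rightarrow> 'a \<Rightarrow> bool) \<Rightarrow> 'a \<Rightarrow> 'a \<Rightarrow> 'a \<Rightarrow> bool" where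
  "lc g u = (\<lambda>a b. g a b \<noteq> (a \<noteq> b \<and> g u a \<and> g u b))"

definition piv :: "('a \<Rightarrow> 'a \<Rightarrow> bool) \<Rightarrow> 'a \<Rightarrow> 'a \<Rightarrow> 'a \<Rightarrow> 'a \<Rightarrow> bool" where
  "piv g u v = lc (lc (lc g u) v) u"

lemma sgraph_lc: "sgraph g \<Longrightarrow> sgraph (lc g u)"
  by (auto simp: sgraph_def lc_def)

lemma sgraph_piv: "sgraph g \<Longrightarrow> sgraph (piv g u v)"
  by (simp add: piv_def sgraph_lc)

lemma lc_lc:
  assumes "sgraph g" shows "lc (lc g u) u = g"
  using assms by (auto simp: lc_def fun_eq_iff sgraph_def)

text \<open>Sort the remaining vertices by the ends that they see: only \<open>u\<close>, only
  \<open>v\<close>, both, or neither. The right-hand side is a binary determinant, so a pivot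
  toggles exactly the pairs from two different ones of the first three classes. All later pivot
  computations rest on this.\<close>

lemma piv_other:
  assumes "sgraph g" "g u v" "a \<noteq> b" "a \<notin> {u, v}" "b \<notin> {u, v}"
  shows "piv g u v a b \<longleftrightarrow> g a b \<noteq> ((g a u \<and> g b v) \<noteq> (g a v \<and> g b u))"
proof -
  have "g v u" "\<not> g u u" "\<not> g v v" "u \<noteq> v" "u \<noteq> a" "u \<noteq> b" "v \<noteq> a" "v \<noteq> b"
    "g u a = g a u" "g u b = g b u" "g v a = g a v" "g v b = g b v"
    using assms by (auto simp: sgraph_def)
  then show ?thesis
    using assms(2-5) unfolding piv_def lc_def
    by (cases "g a u"; cases "g a v"; cases "g b u"; cases "g b v") simp_all
qed

lemma piv_ends:
  assumes "sgraph g" "g u v" "a \<notin> {u, v}"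
  shows "piv g u v u a \<longleftrightarrow> g v a" "piv g u v a u \<longleftrightarrow> g v a"
    "piv g u v v a \<longleftrightarrow> g u a" "piv g u v a v \<longleftrightarrow> g u a"
proof -
  have *: "g v u" "\<not> g u u" "\<not> g v v" "u \<noteq> v" "u \<noteq> a" "v \<noteq> a" "g a u = g u a" "g a v = g v a"
    using assms by (auto simp: sgraph_def)
  show "piv g u v u a \<longleftrightarrow> g v a" "piv g u v a u \<longleftrightarrow> g v a"
    "piv g u v v a \<longleftrightarrow> g u a" "piv g u v a v \<longleftrightarrow> g u a"
    using * assms(2,3) unfolding piv_def lc_def
    by (cases "g u a"; cases "g v a"; simp)+
qed

lemma piv_edge:
  assumes "sgraph g" "g u v"
  shows "piv g u v u v" "piv g u v v u"
proof -
  have *: "g v u" "\<not> g u u" "\<not> g v v" "u \<noteq> v" "v \<noteq> u"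
    using assms by (auto simp: sgraph_def)
  show "piv g u v u v" "piv g u v v u"
    using * assms(2) unfolding piv_def lc_def by simp_all
qed

lemma piv_iff:
  assumes "sgraph g" "g u v" "a \<noteq> b"
  shows "piv g u v a b \<longleftrightarrow>
    (if a = u then b = v \<or> g v b else if a = v then b = u \<or> g u b
     else if b = u then g v a else if b = v then g u a
     else g a b \<noteq> ((g a u \<and> g b v) \<noteq> (g a v \<and> g b u)))"
  using piv_other[OF assms] piv_ends[OF assms(1,2)] piv_edge[OF assms(1,2)] assms(3) by auto

text \<open>Only the pivoted edges are confined to \<open>X\<close>; the relations live on the whole
  type. A sequence of pivots inside a subset is therefore also one inside \<open>X\<close>, and the
  graph need not be restricted when it is split into components.\<close>

inductive orb :: "'a set \<Rightarrow> ('a \<Rightarrow> 'a \<Rightarrow> bool) \<Rightarrow> ('a \<Rightarrow> 'a \<Rightarrow> bool) \<Rightarrow> bool"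
  for X g where
  orb_refl: "orb X g g"
| orb_step: "orb X g h \<Longrightarrow> h u v \<Longrightarrow> u \<in> X \<Longrightarrow> v \<in> X \<Longrightarrow> orb X g (piv h u v)"

lemma orb_trans: "orb X h k \<Longrightarrow> orb X g h \<Longrightarrow> orb X g k"
  by (induction rule: orb.induct) (auto intro: orb.intros)

lemma orb_mono: "orb Y g h \<Longrightarrow> Y \<subseteq> X \<Longrightarrow> orb X g h"
  by (induction rule: orb.induct) (auto intro: orb.intros)

lemma orb_sgraph: "orb X g h \<Longrightarrow> sgraph g \<Longrightarrow> sgraph h"
  by (induction rule: orb.induct) (auto intro: sgraph_piv)

lemma orb_piv: "g u v \<Longrightarrow> u \<in> X \<Longrightarrow> v \<in> X \<Longrightarrow> orb X g (piv g u v)"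
  by (rule orb_step[OF orb_refl])

section \<open>Cut-rank and local complementation\<close>

definition bip_rows :: "('a \<Rightarrow> 'a \<Rightarrow> bool) \<Rightarrow> 'a set \<Rightarrow> 'a set \<Rightarrow> ('a \<Rightarrow> bit) set" where
  "bip_rows g R C = (\<lambda>r c. if c \<in> C \<and> g r c then 1 else 0) ` R"

text \<open>A rank bound witnessed by a spanning set. A linear map on the rows then only requires
  the image of \<open>B\<close>, with no concern for independence.\<close>

definition cut_le :: "nat \<Rightarrow> ('a \<Rightarrow> 'a \<Rightarrow> bool) \<Rightarrow> 'a set \<Rightarrow> 'a set \<Rightarrow> bool" where
  "cut_le k g R C \<longleftrightarrow> (\<exists>B. finite B \<and> card B \<le> k \<and> bip_rows g R C \<subseteq> bit_fun.span B)"

text \<open>Within the cut, complementing at \<open>u\<close> adds row \<open>u\<close> to the rows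
  of the neighbours of \<open>u\<close>, which stays inside the row space.\<close>

lemma cut_le_lc_row:
  assumes "sgraph g" "u \<in> R" "R \<inter> C = {}" "cut_le k g R C"
  shows "cut_le k (lc g u) R C"
proof -
  obtain B where B: "finite B" "card B \<le> k" "bip_rows g R C \<subseteq> bit_fun.span B"
    using assms(4) by (auto simp: cut_le_def)
  let ?w = "\<lambda>g r c. if c \<in> C \<and> g r c then 1 else (0 :: bit)"
  have "?w (lc g u) r \<in> bit_fun.span B" if "r \<in> R" for r
  proof -
    have g: "?w g r \<in> bit_fun.span B" "?w g u \<in> bit_fun.span B"
      using B(3) that assms(2) by (auto simp: bip_rows_def)
    have "?w (lc g u) r = (if g u r then ?w g r + ?w g u else ?w g r)"
      using assms(1,3) that by (auto simp: lc_def fun_eq_iff sgraph_def)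
    then show ?thesis
      using g bit_fun.span_add[OF g] by (cases "g u r") (simp_all only: if_True if_False)
  qed
  then show ?thesis using B(1,2) by (auto simp: cut_le_def bip_rows_def)
qed

text \<open>Dually, column \<open>u\<close> is added to the columns of its neighbours. On row
  vectors this is the linear map \<open>?T\<close>, which carries a spanning set to one that is no
  larger.\<close>

lemma cut_le_lc_col:
  assumes "sgraph g" "u \<in> C" "R \<inter> C = {}" "cut_le k g R C"
  shows "cut_le k (lc g u) R C"
proof -
  obtain B where B: "finite B" "card B \<le> k" "bip_rows g R C \<subseteq> bit_fun.span B"
    using assms(4) by (auto simp: cut_le_def)
  let ?w = "\<lambda>g r c. if c \<in> C \<and> g r c then 1 else (0 :: bit)"
  let ?T = "\<lambda>f c. f c + f u * ?w g u c"
  have T: "?T f \<in> bit_fun.span (?T ` B)" if "f \<in> bit_fun.span B" for f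
    using that
  proof (induction rule: bit_fun.span_induct_alt)
    case base
    have "?T 0 = 0" by (simp add: fun_eq_iff)
    then show ?case by (simp only: bit_fun.span_zero)
  next
    case (step c x y)
    have "?T ((\<lambda>z. c * x z) + y) = (\<lambda>z. c * ?T x z) + ?T y"
      by (rule ext) (simp only: plus_fun_apply distrib_left distrib_right ac_simps)
    then show ?case
      using bit_fun.span_add[OF bit_fun.span_scale[OF bit_fun.span_base[OF imageI[OF step(1)]]] step(2)]
      by (simp only:)
  qed
  have "?w (lc g u) r \<in> bit_fun.span (?T ` B)" if "r \<in> R" for r
  proof -
    have g: "?w g r \<in> bit_fun.span B"
      using B(3) that by (auto simp: bip_rows_def)
    have "?w (lc g u) r = ?T (?w g r)"
      using assms(1-3) that by (auto simp: lc_def fun_eq_iff sgraph_def)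
    then show ?thesis using T[OF g] by (simp only:)
  qed
  moreover have "card (?T ` B) \<le> k"
    using card_image_le[OF B(1), of ?T] B(2) by linarith
  ultimately show ?thesis using B(1) unfolding cut_le_def bip_rows_def by blast
qed

lemma cut_le_lc:
  assumes "sgraph g" "u \<in> X" "S \<subseteq> X"
  shows "cut_le k (lc g u) S (X - S) \<longleftrightarrow> cut_le k g S (X - S)"
proof -
  have imp: "cut_le k (lc h u) S (X - S)" if "sgraph h" "cut_le k h S (X - S)" for h
    using that assms(2,3) cut_le_lc_row[of h u S "X - S" k] cut_le_lc_col[of h u "X - S" S k]
    by blast
  show ?thesis
    using imp[OF assms(1)] imp[OF sgraph_lc[OF assms(1), of u]] lc_lc[OF assms(1)] by metis
qed

lemma cut_le_orb:
  assumes "orb X g h" "sgraph g" "S \<subseteq> X"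
  shows "cut_le k h S (X - S) \<longleftrightarrow> cut_le k g S (X - S)"
  using assms
  by (induction rule: orb.induct) (auto simp: piv_def cut_le_lc sgraph_lc orb_sgraph)

section \<open>Independent sets in the pivot class\<close>

definition claw_free :: "'a set \<Rightarrow> ('a \<Rightarrow> 'a \<Rightarrow> bool) \<Rightarrow> bool" where
  "claw_free X h \<longleftrightarrow> \<not> (\<exists>a\<in>X. \<exists>b\<in>X. \<exists>c\<in>X. \<exists>d\<in>X. distinct [b, c, d] \<and>
     h a b \<and> h a c \<and> h a d \<and> \<not> h b c \<and> \<not> h b d \<and> \<not> h c d)"

definition orb_claw_free :: "'a set \<Rightarrow> ('a \<Rightarrow> 'a \<Rightarrow> bool) \<Rightarrow> bool" where
  "orb_claw_free X g \<longleftrightarrow> (\<forall>h. orb X g h \<longrightarrow> claw_free X h)"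

definition connected_on :: "'a set \<Rightarrow> ('a \<Rightarrow> 'a \<Rightarrow> bool) \<Rightarrow> bool" where
  "connected_on X g \<longleftrightarrow> (\<forall>Y\<subseteq>X. Y \<noteq> {} \<and> Y \<noteq> X \<longrightarrow> (\<exists>y\<in>Y. \<exists>z\<in>X - Y. g y z))"

lemma orb_claw_free_orb: "orb_claw_free X g \<Longrightarrow> orb X g h \<Longrightarrow> orb_claw_free X h"
  unfolding orb_claw_free_def using orb_trans by blast

lemma no_claw:
  assumes "orb_claw_free X h" "{a, b, c, d} \<subseteq> X" "distinct [b, c, d]" "h a b" "h a c" "h a d"
  shows "h b c \<or> h b d \<or> h c d"
  using assms orb_refl[of X h] unfolding orb_claw_free_def claw_free_def by blast

text \<open>The bull is the triangle \<open>a\<close>, \<open>b\<close>, \<open>c\<close> with horns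
  \<open>d\<close> at \<open>a\<close> and \<open>e\<close> at \<open>b\<close>. Pivoting
  \<open>ac\<close> joins \<open>d\<close> to \<open>b\<close> and detaches it from
  \<open>a\<close>, so \<open>b\<close> becomes the centre of a claw with leaves \<open>e\<close>,
  \<open>a\<close>, \<open>d\<close>.\<close>

lemma no_bull:
  assumes "sgraph h" "orb_claw_free X h" "{a, b, c, d, e} \<subseteq> X"
    and "h a b" "h a c" "h b c" "h d a" "h e b"
  shows "h d b \<or> h d c \<or> h d e \<or> h e a \<or> h e c"
proof (rule ccontr)
  assume *: "\<not> ?thesis"
  have c: "h b d = h d b" "h c d = h d c" "h e d = h d e" "h a e = h e a" "h c e = h e c"
    "h b a = h a b" "h c a = h a c" "h c b = h b c" "h a d = h d a" "h b e = h e b"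
    by (rule sgraph_sym[OF assms(1)])+
  have ne: "distinct [a, b, c, d, e]"
    using assms(4-8) c * sgraph_irrefl[OF assms(1)] by auto
  then have ne': "distinct [e, d, c, b, a]" by auto
  let ?k = "piv h a c"
  have "orb_claw_free X ?k"
    using assms(2,3,5) orb_piv orb_claw_free_orb by (metis insert_subset)
  moreover have "?k b e" "?k b a" "?k b d" "\<not> ?k e a" "\<not> ?k e d" "\<not> ?k a d"
    using ne ne' c * assms(4-8) by (simp_all add: piv_iff[OF assms(1,5)])
  ultimately show False
    using no_claw[of X ?k b e a d] ne ne' assms(3) by simp
qed

text \<open>Pivoting the second edge \<open>bc\<close> of the path joins \<open>d\<close> to
  \<open>a\<close> and to \<open>b\<close>, so \<open>d\<close> becomes the centre of a claw with
  leaves \<open>a\<close>, \<open>e\<close>, \<open>b\<close>.\<close>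

lemma no_P5:
  assumes "sgraph h" "orb_claw_free X h" "{a, b, c, d, e} \<subseteq> X"
    and "h a b" "h b c" "h c d" "h d e"
  shows "h a c \<or> h a d \<or> h a e \<or> h b d \<or> h b e \<or> h c e"
proof (rule ccontr)
  assume *: "\<not> ?thesis"
  have c: "h c a = h a c" "h d a = h a d" "h e a = h a e" "h d b = h b d" "h e b = h b e"
    "h e c = h c e" "h b a = h a b" "h c b = h b c" "h d c = h c d" "h e d = h d e"
    by (rule sgraph_sym[OF assms(1)])+
  have ne: "distinct [a, b, c, d, e]"
    using assms(4-7) c * sgraph_irrefl[OF assms(1)] by auto
  then have ne': "distinct [e, d, c, b, a]" by auto
  let ?k = "piv h b c"
  have "orb_claw_free X ?k"
    using assms(2,3,5) orb_piv orb_claw_free_orb by (metis insert_subset)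
  moreover have "?k d a" "?k d e" "?k d b" "\<not> ?k a e" "\<not> ?k a b" "\<not> ?k e b"
    using ne ne' c * assms(4-7) by (simp_all add: piv_iff[OF assms(1,5)])
  ultimately show False
    using no_claw[of X ?k d a e b] ne ne' assms(3) by simp
qed

text \<open>A cut without edges after the pivot has \<open>u\<close> and \<open>v\<close> on one
  side. The ends only exchange their neighbourhoods, so vertices on the other side saw neither of
  them before, and the pivot changed no pair across the cut.\<close>

lemma connected_on_piv:
  assumes "sgraph g" "connected_on X g" "g u v" "u \<in> X" "v \<in> X"
  shows "connected_on X (piv g u v)"
  unfolding connected_on_def
proof (intro allI impI)
  fix Y assume Y: "Y \<subseteq> X" "Y \<noteq> {} \<and> Y \<noteq> X"
  let ?k = "piv g u v"
  show "\<exists>y\<in>Y. \<exists>z\<in>X - Y. ?k y z"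
  proof (rule ccontr)
    assume "\<not> ?thesis"
    then have no: "\<not> ?k y z" "\<not> ?k z y" if "y \<in> Y" "z \<in> X - Y" for y z
      using that sgraph_sym[OF sgraph_piv[OF assms(1)], of u v z y] by blast+
    obtain y z where yz: "y \<in> Y" "z \<in> X - Y" "g y z"
      using assms(2)[unfolded connected_on_def, rule_format, OF Y] by blast
    have k: "?k u v" by (rule piv_edge[OF assms(1,3)])
    have "u \<in> Y \<longleftrightarrow> v \<in> Y"
      using no[of u v] no[of v u] k assms(4,5) by auto
    then consider "u \<in> Y" "v \<in> Y" | "u \<in> X - Y" "v \<in> X - Y"
      using assms(4,5) by blast
    then show False
    proof cases
      case 1
      then have "\<not> g u z" "\<not> g v z"
        using no[of u z] no[of v z] yz piv_ends[OF assms(1,3), of z] by auto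
      moreover have "y \<noteq> z" "z \<notin> {u, v}" using yz 1 by auto
      ultimately show False
        using no[of y z] yz piv_other[OF assms(1,3), of y z] sgraph_sym[OF assms(1), of z u]
          sgraph_sym[OF assms(1), of z v] by auto
    next
      case 2
      then have "\<not> g u y" "\<not> g v y"
        using no[of y u] no[of y v] yz piv_ends[OF assms(1,3), of y] by auto
      moreover have "y \<noteq> z" "y \<notin> {u, v}" using yz 2 by auto
      ultimately show False
        using no[of y z] yz piv_other[OF assms(1,3), of y z] sgraph_sym[OF assms(1), of y u]
          sgraph_sym[OF assms(1), of y v] by auto
    qed
  qed
qed

lemma connected_on_orb:
  assumes "orb X g h" "sgraph g" "connected_on X g"
  shows "connected_on X h"
  using assms by (induction rule: orb.induct) (auto intro: connected_on_piv orb_sgraph)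

text \<open>An edge leaving \<open>?R\<close>, the ball of radius three around \<open>c\<close>,
  would complete an induced path on five vertices.\<close>

lemma distance_le_3:
  assumes "sgraph h" "orb_claw_free X h" "connected_on X h" "c \<in> X" "w \<in> X" "w \<noteq> c" "\<not> h c w"
    and "\<not> (\<exists>t\<in>X. h c t \<and> h t w)"
  obtains t s where "t \<in> X" "s \<in> X" "h c t" "h t s" "h s w" "\<not> h c s" "\<not> h t w"
proof -
  let ?R = "{w\<in>X. w = c \<or> h c w \<or> (\<exists>t\<in>X. h c t \<and> h t w) \<or> (\<exists>t\<in>X. \<exists>s\<in>X. h c t \<and> h t s \<and> h s w)}"
  have "?R = X"
  proof (rule ccontr)
    assume "?R \<noteq> X"
    moreover have "?R \<subseteq> X" "?R \<noteq> {}" using assms(4) by auto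
    ultimately obtain r y where r: "r \<in> ?R" "y \<in> X - ?R" "h r y"
      using assms(3) unfolding connected_on_def by meson
    from r have "r \<noteq> c" "\<not> h c r" "\<not> (\<exists>t\<in>X. h c t \<and> h t r)" by auto
    with r obtain t s where ts: "t \<in> X" "s \<in> X" "h c t" "h t s" "h s r" by auto
    have "\<not> h c s" "\<not> h c r" "\<not> h c y" "\<not> h t r" "\<not> h t y" "\<not> h s y"
      using r ts by auto
    then show False
      using no_P5[OF assms(1,2), of c t s r y] assms(4) r ts by auto
  qed
  then obtain t s where "t \<in> X" "s \<in> X" "h c t" "h t s" "h s w"
    using assms(5-8) by auto
  with assms(8) that show thesis by blast
qed

text \<open>Claws forbid \<open>mc\<close> and \<open>na\<close>. If \<open>m\<close> and
  \<open>n\<close> are not adjacent, then \<open>a m b n c\<close> is an induced path; if they are,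
  the triangle \<open>m\<close>, \<open>n\<close>, \<open>b\<close> with horns \<open>a\<close>,
  \<open>c\<close> is a bull.\<close>

lemma common_nbrs_unique:
  assumes "sgraph h" "orb_claw_free X h" "{a, b, c, m, n} \<subseteq> X" "distinct [a, b, c]"
    and "\<not> h a b" "\<not> h a c" "\<not> h b c" "h m a" "h m b" "h n b" "h n c"
  shows False
proof -
  have s: "h a m = h m a" "h a n = h n a" "h c m = h m c" "h c n = h n c" "h c b = h b c" "h b n = h n b"
    by (rule sgraph_sym[OF assms(1)])+
  have n: "\<not> h m c" "\<not> h n a"
    using no_claw[OF assms(2), of m a b c] no_claw[OF assms(2), of n a b c] assms(3-) by auto
  have "h m n"
    using no_P5[OF assms(1,2), of a m b n c] assms(3-) n s by simp
  then show False
    using no_bull[OF assms(1,2), of m n b a c] assms(3-) n s by simp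
qed

lemma fork_False:
  assumes "sgraph h" "orb_claw_free X h" "{a, b, t, s, s'} \<subseteq> X"
    and "h t s" "h t s'" "h s b" "h s' a" "\<not> h t a" "\<not> h t b" "\<not> h s a" "\<not> h s' b" "\<not> h a b"
  shows False
proof -
  have s: "h s t = h t s" "h s' t = h t s'" "h b s = h s b" "h a s' = h s' a" "h b t = h t b"
    "h b s' = h s' b" "h b a = h a b" "h a t = h t a" "h a s = h s a"
    by (rule sgraph_sym[OF assms(1)])+
  have "h s s'"
    using no_P5[OF assms(1,2), of b s t s' a] assms(3-) s by simp
  then show False
    using no_bull[OF assms(1,2), of s s' t b a] assms(3-) s by simp
qed

text \<open>Both \<open>a\<close> and \<open>b\<close> are at distance three from \<open>c\<close>.
  Two shortest paths \<open>c t s b\<close> and \<open>c t' s' a\<close> are compared until the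
  triangle \<open>t\<close>, \<open>t'\<close>, \<open>c\<close> with horns \<open>s\<close>,
  \<open>s'\<close> is seen to be a bull.\<close>

lemma remote_False:
  assumes "sgraph h" "orb_claw_free X h" "connected_on X h" "{a, b, c} \<subseteq> X" "distinct [a, b, c]"
    and "\<not> h a b" "\<not> h a c" "\<not> h b c"
    and "\<not> (\<exists>t\<in>X. h c t \<and> h t a)" "\<not> (\<exists>t\<in>X. h c t \<and> h t b)"
  shows False
proof -
  have abc: "a \<in> X" "b \<in> X" "c \<in> X" "h c a = h a c" "h c b = h b c" "h b a = h a b" "a \<noteq> b"
    using assms(4,5) sgraph_sym[OF assms(1)] by simp_all
  obtain t s where ts: "t \<in> X" "s \<in> X" "h c t" "h t s" "h s b" "\<not> h c s" "\<not> h t b"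
    by (rule distance_le_3[OF assms(1-3), of c b]) (use assms(5-10) abc in auto)
  obtain t' s' where ts': "t' \<in> X" "s' \<in> X" "h c t'" "h t' s'" "h s' a" "\<not> h c s'" "\<not> h t' a"
    by (rule distance_le_3[OF assms(1-3), of c a]) (use assms(5-10) abc in auto)
  have n: "\<not> h t a" "\<not> h t' b"
    using assms(9,10) ts ts' by auto
  have s: "h s t = h t s" "h s' t' = h t' s'" "h t c = h c t" "h t' c = h c t'" "h b s = h s b"
    "h b t = h t b" "h b t' = h t' b" "h b s' = h s' b" "h s c = h c s" "h s' c = h c s'"
    "h s t' = h t' s" "h s' t = h t s'" "h s' s = h s s'" "h a t = h t a" "h a t' = h t' a"
    by (rule sgraph_sym[OF assms(1)])+
  have ne: "a \<noteq> t" "b \<noteq> t" "a \<noteq> t'" "b \<noteq> t'" "b \<noteq> s'" "s' \<noteq> t"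
    using ts ts' n abc assms(6-8) s by auto
  have m: "\<not> h s a" "\<not> h s' b"
    using no_claw[OF assms(2), of s a b t] no_claw[OF assms(2), of s' a b t']
      assms(6) abc ts ts' n s ne by auto
  then have "s \<noteq> s'" using ts' by auto
  note ne = ne this
  have f: "\<not> h t s'" "\<not> h t' s"
    using fork_False[OF assms(1,2), of a b t s s'] fork_False[OF assms(1,2), of a b t' s s']
      assms(6) abc ts ts' n m by auto
  have "h t t'"
    using no_P5[OF assms(1,2), of b s t c t'] assms(6-8) abc ts ts' n f m s by auto
  moreover have "\<not> h s s'"
    using no_claw[OF assms(2), of s b s' t] assms(6-8) abc ts ts' n f m s ne by auto
  ultimately show False
    using no_bull[OF assms(1,2), of t t' c s s'] abc ts ts' n f m s by auto
qed

section \<open>Graphs without three independent vertices\<close>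

definition alpha2 :: "'a set \<Rightarrow> ('a \<Rightarrow> 'a \<Rightarrow> bool) \<Rightarrow> bool" where
  "alpha2 X h \<longleftrightarrow> (\<forall>a\<in>X. \<forall>b\<in>X. \<forall>c\<in>X. distinct [a, b, c] \<longrightarrow> h a b \<or> h a c \<or> h b c)"

text \<open>By \<open>remote_False\<close>, each of three independent vertices has a common
  neighbour with another one, so at least two of the three pairs have one. Two such pairs share a
  vertex, against \<open>common_nbrs_unique\<close>.\<close>

lemma connected_alpha2:
  assumes "sgraph h" "orb_claw_free X h" "connected_on X h"
  shows "alpha2 X h"
  unfolding alpha2_def
proof (intro ballI impI, rule ccontr)
  fix a b c assume abc: "a \<in> X" "b \<in> X" "c \<in> X" "distinct [a, b, c]"
    and "\<not> (h a b \<or> h a c \<or> h b c)"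
  then have n: "\<not> h a b" "\<not> h a c" "\<not> h b c" "\<not> h b a" "\<not> h c a" "\<not> h c b"
    by (simp_all add: sgraph_sym[OF assms(1), of b a] sgraph_sym[OF assms(1), of c])
  define N where "N = (\<lambda>a b. \<exists>t\<in>X. h a t \<and> h t b)"
  have N: "N a b \<longleftrightarrow> N b a" for a b
    unfolding N_def using sgraph_sym[OF assms(1)] by metis
  have one: "\<not> (N a b \<and> N b c)"
    if "{a, b, c} \<subseteq> X" "distinct [a, b, c]" "\<not> h a b" "\<not> h a c" "\<not> h b c" for a b c
  proof
    assume "N a b \<and> N b c"
    then obtain m m' where "m \<in> X" "h a m" "h m b" "m' \<in> X" "h b m'" "h m' c"
      unfolding N_def by blast
    then show False
      using common_nbrs_unique[OF assms(1,2), of a b c m m'] that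
        sgraph_sym[OF assms(1), of m a] sgraph_sym[OF assms(1), of m' b] by simp
  qed
  have two: "N c a \<or> N c b"
    if "{a, b, c} \<subseteq> X" "distinct [a, b, c]" "\<not> h a b" "\<not> h a c" "\<not> h b c" for a b c
    using remote_False[OF assms, of a b c] that unfolding N_def by blast
  show False
    using one[of a b c] one[of a c b] one[of b a c] two[of a b c] two[of a c b] two[of b c a]
      N[of a b] N[of b c] N[of a c] abc n by auto
qed

definition orb_alpha2 :: "'a set \<Rightarrow> ('a \<Rightarrow> 'a \<Rightarrow> bool) \<Rightarrow> bool" where
  "orb_alpha2 X g \<longleftrightarrow> (\<forall>h. orb X g h \<longrightarrow> alpha2 X h)"

lemma orb_alpha2I:
  assumes "sgraph g" "orb_claw_free X g" "connected_on X g"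
  shows "orb_alpha2 X g"
  unfolding orb_alpha2_def
  using assms connected_alpha2 orb_sgraph orb_claw_free_orb connected_on_orb by blast

lemma orb_alpha2_orb: "orb_alpha2 X g \<Longrightarrow> orb X g h \<Longrightarrow> orb_alpha2 X h"
  unfolding orb_alpha2_def using orb_trans by blast

lemma orb_alpha2D:
  assumes "orb_alpha2 X g" "{a, b, c} \<subseteq> X" "distinct [a, b, c]"
  shows "g a b \<or> g a c \<or> g b c"
  using assms orb_refl[of X g] unfolding orb_alpha2_def alpha2_def by blast

text \<open>Here \<open>ab\<close> and \<open>cd\<close> are the missing diagonals of the rim and
  \<open>e\<close> is the hub. Pivoting \<open>ea\<close> removes \<open>bc\<close> and
  \<open>bd\<close> and does not affect \<open>cd\<close>, so \<open>b\<close>, \<open>c\<close>,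
  \<open>d\<close> become independent.\<close>

lemma no_W4:
  assumes "sgraph h" "orb_alpha2 X h" "{a, b, c, d, e} \<subseteq> X"
    and "a \<noteq> b" "c \<noteq> d" "\<not> h a b" "\<not> h c d" "h a c" "h a d" "h b c" "h b d"
    and "h e a" "h e b" "h e c" "h e d"
  shows False
proof -
  have s: "h c a = h a c" "h d a = h a d" "h c b = h b c" "h d b = h b d" "h a e = h e a"
    "h b e = h e b" "h c e = h e c" "h d e = h e d" "h b a = h a b" "h d c = h c d"
    by (rule sgraph_sym[OF assms(1)])+
  have ne: "distinct [a, b, c, d, e]"
    using assms(3-) s sgraph_irrefl[OF assms(1)] by auto
  then have ne': "distinct [e, d, c, b, a]" by auto
  let ?k = "piv h e a"
  have "orb_alpha2 X ?k"
    using assms(2,3,12) orb_piv orb_alpha2_orb by (metis insert_subset)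
  moreover have "\<not> ?k b c" "\<not> ?k b d" "\<not> ?k c d"
    using ne ne' s assms(3-) by (simp_all add: piv_iff[OF assms(1,12)])
  ultimately show False
    using orb_alpha2D[of X ?k b c d] ne ne' assms(3) by simp
qed

section \<open>Enlarging two cliques by pivoting\<close>

text \<open>The hypothesis says that the neighbourhoods in \<open>B\<close> form a chain under
  inclusion; \<open>u\<close> has the smallest one.\<close>

lemma nested_least:
  assumes "finite A" "A \<noteq> {}"
    and "\<And>a a' b b'. a \<in> A \<Longrightarrow> a' \<in> A \<Longrightarrow> b \<in> B \<Longrightarrow> b' \<in> B \<Longrightarrow> R a b \<Longrightarrow> R a' b' \<Longrightarrow> R a b' \<or> R a' b"
  obtains u where "u \<in> A" "\<And>a b. a \<in> A \<Longrightarrow> b \<in> B \<Longrightarrow> R u b \<Longrightarrow> R a b"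
proof -
  have "\<exists>u\<in>A. \<forall>a\<in>A. \<forall>b\<in>B. R u b \<longrightarrow> R a b"
    using assms
  proof (induction rule: finite_ne_induct)
    case (singleton c)
    show ?case by simp
  next
    case (insert c A)
    have "\<exists>u\<in>A. \<forall>a\<in>A. \<forall>b\<in>B. R u b \<longrightarrow> R a b"
      by (rule insert.IH) (rule insert.prems; simp)
    then obtain u where u: "u \<in> A" "\<forall>a\<in>A. \<forall>b\<in>B. R u b \<longrightarrow> R a b"
      by blast
    show ?case
    proof (cases "\<forall>b\<in>B. R u b \<longrightarrow> R c b")
      case True
      then show ?thesis using u by (intro bexI[of _ u]) auto
    next
      case False
      then obtain b0 where b0: "b0 \<in> B" "R u b0" "\<not> R c b0" by blast
      have "R u b" if "b \<in> B" "R c b" for b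
        using insert.prems[of u c b0 b] that b0 u(1) by simp
      then show ?thesis using u by (intro bexI[of _ c]) auto
    qed
  qed
  then obtain u where u: "u \<in> A" "\<forall>a\<in>A. \<forall>b\<in>B. R u b \<longrightarrow> R a b" by blast
  show thesis by (rule that[of u]) (use u in auto)
qed

text \<open>If the smallest neighbourhood is empty, the first alternative holds; otherwise each of
  its elements lies in all neighbourhoods.\<close>

lemma nested_dichotomy:
  assumes "finite A" "A \<noteq> {}"
    and "\<And>a a' b b'. a \<in> A \<Longrightarrow> a' \<in> A \<Longrightarrow> b \<in> B \<Longrightarrow> b' \<in> B \<Longrightarrow> R a b \<Longrightarrow> R a' b' \<Longrightarrow> R a b' \<or> R a' b"
  shows "(\<exists>u\<in>A. \<forall>b\<in>B. \<not> R u b) \<or> (\<exists>b\<in>B. \<forall>a\<in>A. R a b)"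
proof (rule nested_least[OF assms])
  fix u assume "u \<in> A" "\<And>a b. a \<in> A \<Longrightarrow> b \<in> B \<Longrightarrow> R u b \<Longrightarrow> R a b"
  then show ?thesis by blast
qed

section \<open>Pairs of cliques and the effect of a pivot on them\<close>

definition clique_on :: "('a \<Rightarrow> 'a \<Rightarrow> bool) \<Rightarrow> 'a set \<Rightarrow> bool" where
  "clique_on h A \<longleftrightarrow> (\<forall>a\<in>A. \<forall>b\<in>A. a \<noteq> b \<longrightarrow> h a b)"

text \<open>The covered set \<open>S\<close> stays fixed while the graph ranges over the pivot
  class, so that maximality of \<open>S\<close> is unaffected by pivoting.\<close>

definition two_cliques :: "'a set \<Rightarrow> ('a \<Rightarrow> 'a \<Rightarrow> bool) \<Rightarrow> 'a set \<Rightarrow> bool" where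
  "two_cliques X g S \<longleftrightarrow> (\<exists>h A B. orb X g h \<and> A \<union> B = S \<and> clique_on h A \<and> clique_on h B)"

lemma clique_onD: "clique_on h A \<Longrightarrow> a \<in> A \<Longrightarrow> b \<in> A \<Longrightarrow> a \<noteq> b \<Longrightarrow> h a b"
  by (simp add: clique_on_def)

lemma clique_on_Un:
  assumes "sgraph h" "clique_on h A" "clique_on h B" "\<And>a b. a \<in> A \<Longrightarrow> b \<in> B \<Longrightarrow> a \<noteq> b \<Longrightarrow> h a b"
  shows "clique_on h (A \<union> B)"
  unfolding clique_on_def
proof (intro ballI impI)
  fix a b assume "a \<in> A \<union> B" "b \<in> A \<union> B" "a \<noteq> b"
  then show "h a b"
    using clique_onD[OF assms(2), of a b] clique_onD[OF assms(3), of a b] assms(4)[of a b]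
      assms(4)[of b a] sgraph_sym[OF assms(1), of a b] by auto
qed

lemma clique_on_insert:
  assumes "sgraph h" "clique_on h A" "\<And>a. a \<in> A \<Longrightarrow> h x a"
  shows "clique_on h (insert x A)"
  using clique_on_Un[of h "{x}" A] assms by (simp add: clique_on_def)

lemma clique_on_subset: "clique_on h A \<Longrightarrow> B \<subseteq> A \<Longrightarrow> clique_on h B"
  by (auto simp: clique_on_def)

lemma two_cliquesI:
  "orb X g h \<Longrightarrow> clique_on h A \<Longrightarrow> clique_on h B \<Longrightarrow> A \<union> B = S \<Longrightarrow> two_cliques X g S"
  by (auto simp: two_cliques_def)

lemma two_cliques_orb: "orb X g h \<Longrightarrow> two_cliques X h S \<Longrightarrow> two_cliques X g S"
  unfolding two_cliques_def by (metis orb_trans)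

text \<open>Apart from \<open>x\<close>, the vertices \<open>s\<close> and \<open>t\<close> are twins, so the only effect of the pivot up to swapping
  them is to complement the edges between \<open>x\<close> and the common neighbours of \<open>s\<close> and \<open>t\<close>.\<close>

lemma pivot_twins:
  assumes "sgraph h" "clique_on h S" "clique_on h T" "S \<inter> T = {}" "x \<notin> S \<union> T"
    and "s \<in> S" "t \<in> S" "s \<noteq> t" "s \<in> X" "t \<in> X" "\<not> h x s" "h x t"
    and T: "\<And>c. c \<in> T \<Longrightarrow> h c s \<longleftrightarrow> h c t" "\<And>c. c \<in> T \<Longrightarrow> h x c \<longleftrightarrow> \<not> h c s"
  shows "two_cliques X h (S \<union> T \<union> {x})"
proof -
  let ?k = "piv h s t"
  have st: "h s t" using assms(2,6-8) by (auto simp: clique_on_def)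
  have S: "h a b" if "a \<in> S" "b \<in> S" "a \<noteq> b" for a b
    using assms(2) that by (auto simp: clique_on_def)
  have k: "sgraph ?k" by (rule sgraph_piv[OF assms(1)])
  have cS: "clique_on ?k S"
    unfolding clique_on_def
  proof (intro ballI impI)
    fix a b assume "a \<in> S" "b \<in> S" "a \<noteq> b"
    then show "?k a b"
      using S[of a b] S[of b a] S[of a s] S[of a t] S[of b s] S[of b t] S[of s b] S[of t b] S[of s a]
        S[of t a] assms(6,7) piv_iff[OF assms(1) st, of a b] by auto
  qed
  have "clique_on ?k T"
    unfolding clique_on_def
  proof (intro ballI impI)
    fix a b assume ab: "a \<in> T" "b \<in> T" "a \<noteq> b"
    then have "a \<notin> {s, t}" "b \<notin> {s, t}" using assms(4,6,7) by auto
    then show "?k a b"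
      using piv_other[OF assms(1) st ab(3)] T(1)[OF ab(1)] T(1)[OF ab(2)] clique_onD[OF assms(3) ab]
      by auto
  qed
  then have cT: "clique_on ?k (insert x T)"
  proof (rule clique_on_insert[OF k])
    fix c assume c: "c \<in> T"
    then have "x \<noteq> c" "x \<notin> {s, t}" "c \<notin> {s, t}" using assms(4-7) by auto
    then show "?k x c"
      using piv_other[OF assms(1) st, of x c] T[OF c] assms(11,12) by auto
  qed
  show ?thesis
    by (rule two_cliquesI[OF orb_piv[of h, OF st assms(9,10)] cS cT]) auto
qed

text \<open>Apart from \<open>u\<close> and \<open>v\<close> themselves, \<open>A\<close> sees only
  \<open>u\<close>, \<open>B\<close> sees only \<open>v\<close>, the rest of \<open>P\<close> and
  \<open>Q\<close> sees both ends, and \<open>x\<close> sees neither. The pivot fills in all pairs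
  between \<open>A\<close> and \<open>B\<close>, which regroups the vertices into \<open>A\<close>,
  \<open>B\<close>, \<open>x\<close> on one side and the rest of \<open>P\<close> and
  \<open>Q\<close> on the other.\<close>

lemma pivot_across:
  assumes "sgraph h" "clique_on h P" "clique_on h Q" "P \<inter> Q = {}" "x \<notin> P \<union> Q"
    and "u \<in> P" "v \<in> Q" "u \<in> X" "v \<in> X" "h u v" "\<not> h x u" "\<not> h x v"
    and A: "A = {p\<in>P. \<not> h p v}" and B: "B = {q\<in>Q. \<not> h q u}"
    and xA: "\<And>a. a \<in> A \<Longrightarrow> h x a" and xB: "\<And>b. b \<in> B \<Longrightarrow> h x b"
    and AB: "\<And>a b. a \<in> A \<Longrightarrow> b \<in> B \<Longrightarrow> \<not> h a b"
    and PQ: "\<And>p q. p \<in> P - A \<Longrightarrow> q \<in> Q - B \<Longrightarrow> h p q"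
  shows "two_cliques X h (P \<union> Q \<union> {x})"
proof -
  let ?k = "piv h u v"
  have k: "sgraph ?k" by (rule sgraph_piv[OF assms(1)])
  have uv: "h v u" using sgraph_sym[OF assms(1)] assms(10) by simp
  have P: "h p p'" if "p \<in> P" "p' \<in> P" "p \<noteq> p'" for p p'
    using assms(2) that by (auto simp: clique_on_def)
  have Q: "h p p'" if "p \<in> Q" "p' \<in> Q" "p \<noteq> p'" for p p'
    using assms(3) that by (auto simp: clique_on_def)
  have clsA: "a \<notin> {u, v}" "h a u" "\<not> h a v" "a \<in> P" "a \<noteq> x" if "a \<in> A" for a
    using that assms(4-7,10) P[of a u] by (auto simp: A)
  have clsB: "b \<notin> {u, v}" "\<not> h b u" "h b v" "b \<in> Q" "b \<noteq> x" if "b \<in> B" for b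
    using that assms(4-7) uv Q[of b v] by (auto simp: B)
  have x: "x \<notin> {u, v}" using assms(5-7) by auto
  have clsP: "h p v" "h v p" "p \<noteq> v" "p \<in> P" if "p \<in> P - A" for p
    using that sgraph_sym[OF assms(1), of v p] assms(4,7) by (auto simp: A)
  have clsQ: "h q u" "h u q" "q \<noteq> u" "q \<in> Q" if "q \<in> Q - B" for q
    using that sgraph_sym[OF assms(1), of u q] assms(4,6) by (auto simp: B)
  have "clique_on ?k A"
    unfolding clique_on_def
    using clsA P piv_other[OF assms(1,10)] by simp
  moreover have "clique_on ?k B"
    unfolding clique_on_def
    using clsB Q piv_other[OF assms(1,10)] by simp
  moreover have "?k a b" if "a \<in> A" "b \<in> B" "a \<noteq> b" for a b
    using that clsA[of a] clsB[of b] AB[of a b] piv_other[OF assms(1,10), of a b] by simp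
  ultimately have "clique_on ?k (A \<union> B)"
    by (rule clique_on_Un[OF k])
  then have S: "clique_on ?k (insert x (A \<union> B))"
  proof (rule clique_on_insert[OF k])
    fix c assume "c \<in> A \<union> B"
    then have "c \<notin> {u, v}" "x \<noteq> c" "h x c" using clsA[of c] clsB[of c] xA[of c] xB[of c] by auto
    then show "?k x c"
      using piv_other[OF assms(1,10), of x c] x assms(11,12) by simp
  qed
  have Pu: "h p u \<and> h u p" if "p \<in> P - A" "p \<noteq> u" for p
    using that P[of p u] P[of u p] assms(6) by auto
  have Qv: "h q v \<and> h v q" if "q \<in> Q - B" "q \<noteq> v" for q
    using that Q[of q v] Q[of v q] assms(7) by auto
  have "clique_on ?k (P - A)"
    unfolding clique_on_def
  proof (intro ballI impI)
    fix p p' assume "p \<in> P - A" "p' \<in> P - A" "p \<noteq> p'"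
    then show "?k p p'"
      using clsP[of p] clsP[of p'] Pu[of p] Pu[of p'] P[of p p'] piv_iff[OF assms(1,10), of p p'] by auto
  qed
  moreover have "clique_on ?k (Q - B)"
    unfolding clique_on_def
  proof (intro ballI impI)
    fix p p' assume "p \<in> Q - B" "p' \<in> Q - B" "p \<noteq> p'"
    then show "?k p p'"
      using clsQ[of p] clsQ[of p'] Qv[of p] Qv[of p'] Q[of p p'] piv_iff[OF assms(1,10), of p p'] by auto
  qed
  moreover have "?k p q" if "p \<in> P - A" "q \<in> Q - B" "p \<noteq> q" for p q
    using that clsP[of p] clsQ[of q] Pu[of p] Qv[of q] PQ[of p q] piv_iff[OF assms(1,10), of p q] by auto
  ultimately have T: "clique_on ?k ((P - A) \<union> (Q - B))"
    by (rule clique_on_Un[OF k])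
  show ?thesis
    by (rule two_cliquesI[OF orb_piv[of h, OF assms(10,8,9)] S T]) (auto simp: A B)
qed

section \<open>A vertex outside two cliques\<close>

definition adj :: "('a \<Rightarrow> 'a \<Rightarrow> bool) \<Rightarrow> 'a \<Rightarrow> 'a set \<Rightarrow> 'a set" where
  "adj h x P = {p\<in>P. h x p}"

definition nonadj :: "('a \<Rightarrow> 'a \<Rightarrow> bool) \<Rightarrow> 'a \<Rightarrow> 'a set \<Rightarrow> 'a set" where
  "nonadj h x P = {p\<in>P. \<not> h x p}"

text \<open>The setting is symmetric in \<open>P\<close> and \<open>Q\<close>; \<open>swap\<close>
  gives the mirror image of every fact. In the abbreviations, index 0 stands for neighbours of
  \<open>x\<close> and index 1 for non-neighbours.\<close>

locale two_cliques_vertex =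
  fixes X :: "'a set" and h P Q x
  assumes sg: "sgraph h" and al: "orb_alpha2 X h"
    and sub: "P \<subseteq> X" "Q \<subseteq> X" "x \<in> X" and fin: "finite P" "finite Q"
    and disj: "P \<inter> Q = {}" "x \<notin> P" "x \<notin> Q"
    and clP: "clique_on h P" and clQ: "clique_on h Q"
begin

abbreviation "P0 \<equiv> adj h x P"
abbreviation "P1 \<equiv> nonadj h x P"
abbreviation "Q0 \<equiv> adj h x Q"
abbreviation "Q1 \<equiv> nonadj h x Q"

lemma sym: "h a b \<longleftrightarrow> h b a"
  by (rule sgraph_sym[OF sg])

lemma swap: "two_cliques_vertex X h Q P x"
  by unfold_locales (use sg al sub fin disj clP clQ in auto)

lemma parts: "P = P0 \<union> P1" "Q = Q0 \<union> Q1" "P0 \<inter> P1 = {}" "Q0 \<inter> Q1 = {}"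
  by (auto simp: adj_def nonadj_def)

lemma P0D: "p \<in> P0 \<Longrightarrow> p \<in> P \<and> p \<in> X \<and> h x p \<and> h p x \<and> p \<noteq> x \<and> p \<notin> Q"
  using sub disj sym[of x p] by (auto simp: adj_def)

lemma P1D: "p \<in> P1 \<Longrightarrow> p \<in> P \<and> p \<in> X \<and> \<not> h x p \<and> \<not> h p x \<and> p \<noteq> x \<and> p \<notin> Q"
  using sub disj sym[of x p] by (auto simp: nonadj_def)

lemma Q0D: "q \<in> Q0 \<Longrightarrow> q \<in> Q \<and> q \<in> X \<and> h x q \<and> h q x \<and> q \<noteq> x \<and> q \<notin> P"
  by (rule two_cliques_vertex.P0D[OF swap])

lemma Q1D: "q \<in> Q1 \<Longrightarrow> q \<in> Q \<and> q \<in> X \<and> \<not> h x q \<and> \<not> h q x \<and> q \<noteq> x \<and> q \<notin> P"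
  by (rule two_cliques_vertex.P1D[OF swap])

lemma inP: "a \<in> P \<Longrightarrow> b \<in> P \<Longrightarrow> a \<noteq> b \<Longrightarrow> h a b"
  using clP by (auto simp: clique_on_def)

lemma inQ: "a \<in> Q \<Longrightarrow> b \<in> Q \<Longrightarrow> a \<noteq> b \<Longrightarrow> h a b"
  using clQ by (auto simp: clique_on_def)

lemma P1Q1: assumes "p \<in> P1" "q \<in> Q1" shows "h p q"
  using orb_alpha2D[OF al, of x p q] P1D[OF assms(1)] Q1D[OF assms(2)] sub by auto

text \<open>Otherwise the four vertices form a four-cycle with hub \<open>v\<close>, which sees
  \<open>p\<close>, \<open>p'\<close> by \<open>P1Q1\<close> and \<open>q\<close>, \<open>q'\<close>
  inside the clique.\<close>

lemma P1Q0_nested: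
  assumes "v \<in> Q1" "p \<in> P1" "p' \<in> P1" "q \<in> Q0" "q' \<in> Q0" "h p q" "h p' q'"
  shows "h p q' \<or> h p' q"
proof (rule ccontr)
  assume *: "\<not> ?thesis"
  then have "p \<noteq> p'" "q \<noteq> q'" using assms(6,7) by auto
  moreover have "v \<noteq> q" "v \<noteq> q'" using assms(1,4,5) parts by auto
  ultimately show False
    using no_W4[OF sg al, of p' q p q' v] * assms(6,7) P1D[OF assms(2)] P1D[OF assms(3)]
      Q0D[OF assms(4)] Q0D[OF assms(5)] Q1D[OF assms(1)] P1Q1[OF assms(2,1)] P1Q1[OF assms(3,1)]
      sym[of v p] sym[of v p'] sym[of q p] inP[of p' p] inQ[of q q'] inQ[of v q] inQ[of v q']
    by auto
qed

lemma P0Q0_nested: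
  assumes "p \<in> P0" "p' \<in> P0" "q \<in> Q0" "q' \<in> Q0" "h p q" "h p' q'"
  shows "h p q' \<or> h p' q"
proof (rule ccontr)
  assume *: "\<not> ?thesis"
  then have "p \<noteq> p'" "q \<noteq> q'" using assms(5,6) by auto
  then show False
    using no_W4[OF sg al, of p' q p q' x] * assms(5,6) P0D[OF assms(1)] P0D[OF assms(2)]
      Q0D[OF assms(3)] Q0D[OF assms(4)] sub(3) sym[of q p] inP[of p' p] inQ[of q q']
    by auto
qed

text \<open>A non-edge \<open>pq\<close> would be a diagonal of the four-cycle
  \<open>x p p1 q\<close> with hub \<open>p'\<close>. Hence a vertex of \<open>Q0\<close> with a
  neighbour in \<open>P1\<close> sees all of \<open>P0\<close> or nothing of it.\<close>

lemma P0_uniform: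
  assumes "p1 \<in> P1" "q \<in> Q0" "h p1 q" "p \<in> P0" "p' \<in> P0" "h p' q"
  shows "h p q"
proof (rule ccontr)
  assume *: "\<not> ?thesis"
  then have "p \<noteq> p'" using assms(6) by auto
  moreover have "p1 \<noteq> p" "p1 \<noteq> p'" using assms(1,4,5) parts by auto
  ultimately show False
    using no_W4[OF sg al, of x p1 p q p'] * assms(3,6) P1D[OF assms(1)] Q0D[OF assms(2)]
      P0D[OF assms(4)] P0D[OF assms(5)] sub(3) inP[of p1 p] inP[of p' p] inP[of p' p1]
    by auto
qed

text \<open>The edge for \<open>pivot_across\<close> joins vertices \<open>u\<close> and
  \<open>v\<close> with smallest neighbourhoods in \<open>Q0\<close> and \<open>P0\<close>.
  Minimality makes the vertices outside \<open>A\<close> and \<open>B\<close> complete to each other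
  where \<open>P1\<close> or \<open>Q1\<close> is involved; for the remaining conditions
  \<open>q0\<close>, or once \<open>p1\<close>, is a hub.\<close>

lemma extend_if_full_vertex:
  assumes q0: "q0 \<in> Q0" "\<And>p. p \<in> P0 \<Longrightarrow> h p q0" and p1: "p1 \<in> P1" "h p1 q0"
    and a0: "a0 \<in> P0" "v0 \<in> Q1" "\<not> h a0 v0"
  shows "two_cliques X h (P \<union> Q \<union> {x})"
proof -
  have ne: "P1 \<noteq> {}" "Q1 \<noteq> {}" using p1 a0 by auto
  have fin': "finite P1" "finite Q1" using fin by (auto simp: nonadj_def)
  obtain u where u: "u \<in> P1" "\<And>p q. p \<in> P1 \<Longrightarrow> q \<in> Q0 \<Longrightarrow> h u q \<Longrightarrow> h p q"
    using nested_least[of P1 Q0 h] fin' ne P1Q0_nested[OF a0(2)] by blast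
  obtain v where v: "v \<in> Q1" "\<And>q p. q \<in> Q1 \<Longrightarrow> p \<in> P0 \<Longrightarrow> h v p \<Longrightarrow> h q p"
    using nested_least[of Q1 P0 h] fin' ne two_cliques_vertex.P1Q0_nested[OF swap p1(1)] by blast
  define A where "A = {p\<in>P. \<not> h p v}"
  define B where "B = {q\<in>Q. \<not> h q u}"
  have A: "a \<in> P0" "\<not> h a v" if "a \<in> A" for a
    using that P1Q1[of a v] v(1) parts(1) by (auto simp: A_def)
  have B: "b \<in> Q0" "\<not> h b u" if "b \<in> B" for b
    using that P1Q1[of u b] u(1) parts(2) sym[of b u] by (auto simp: B_def)
  note uD = P1D[OF u(1)] and vD = Q1D[OF v(1)] and uv = P1Q1[OF u(1) v(1)]
  note qD = Q0D[OF q0(1)] and pD = P1D[OF p1(1)]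
  \<comment> \<open>An edge \<open>ab\<close> lies on the four-cycle \<open>a u v b\<close>. Its hub
    is \<open>q0\<close> if \<open>u\<close> sees \<open>q0\<close>, and \<open>p1\<close> if
    instead \<open>p1\<close> sees \<open>b\<close>; otherwise \<open>p1\<close> replaces
    \<open>u\<close> in the cycle and \<open>q0\<close> is a hub again.\<close>
  have AB: "\<not> h a b" if ab: "a \<in> A" "b \<in> B" for a b
  proof
    assume h: "h a b"
    note aD = P0D[OF A(1)[OF ab(1)]] and bD = Q0D[OF B(1)[OF ab(2)]]
    have ne: "a \<noteq> u" "a \<noteq> p1" "b \<noteq> v" "q0 \<noteq> v" using aD uD pD bD vD qD by auto
    have bu: "\<not> h u b" using B(2)[OF ab(2)] sym[of u b] by simp
    have av: "\<not> h a v" using A(2)[OF ab(1)] .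
    have s: "h v u" "h v p1" "h q0 a" using uv P1Q1[OF p1(1) v(1)] q0(2)[OF A(1)[OF ab(1)]] sym by auto
    show False
    proof (cases "h u q0")
      case True
      then have "q0 \<noteq> b" using bu by auto
      then show False
        using no_W4[OF sg al, of a v u b q0] aD bD uD vD qD ne h av bu s True sym[of q0 u]
          inP[of a u] inQ[of v b] inQ[of q0 v] inQ[of q0 b] by auto
    next
      case False
      show False
      proof (cases "h p1 b")
        case True
        then show False
          using no_W4[OF sg al, of a v u b p1] False aD bD uD vD pD ne h av bu s p1(2)
            P1Q1[OF p1(1) v(1)] inP[of a u] inQ[of v b] inP[of p1 a] inP[of p1 u] by auto
      next
        case f: False
        then have "q0 \<noteq> b" using p1 by auto
        then show False
          using no_W4[OF sg al, of a v p1 b q0] aD bD pD vD qD ne h av f s p1(2) sym[of q0 p1]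
            inP[of a p1] inQ[of v b] inQ[of q0 v] inQ[of q0 b] by auto
      qed
    qed
  qed
  \<comment> \<open>The non-edge \<open>a0 v0\<close> becomes a non-edge \<open>a0 v\<close> by
    minimality of \<open>v\<close>. A member of \<open>A\<close> keeps \<open>q0\<close> out of
    \<open>B\<close>, so \<open>u\<close> sees \<open>q0\<close>.\<close>
  have "a0 \<in> A" using a0 P0D[OF a0(1)] v(2)[of v0 a0] sym[of v a0] sym[of v0 a0] by (auto simp: A_def)
  then have q0B: "q0 \<notin> B" using AB q0(2) A(1) by blast
  then have uq0: "h q0 u" using qD by (auto simp: B_def)
  \<comment> \<open>Minimality and \<open>P1Q1\<close> settle pairs that meet \<open>P1\<close> or
    \<open>Q1\<close>. A non-edge between \<open>P0\<close> and \<open>Q0\<close> is a diagonal of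
    the four-cycle \<open>p x q u\<close> with hub \<open>q0\<close>.\<close>
  have PQ: "h p q" if pq: "p \<in> P - A" "q \<in> Q - B" for p q
  proof (rule ccontr)
    assume n: "\<not> h p q"
    have pv: "h p v" and qu: "h q u" using pq by (auto simp: A_def B_def)
    have "p \<in> P0"
    proof (rule ccontr)
      assume "p \<notin> P0"
      then have "p \<in> P1" using pq parts by auto
      then show False using n P1Q1[of p q] u(2)[of p q] qu sym[of u q] pq parts(2) by auto
    qed
    moreover have "q \<in> Q0"
    proof (rule ccontr)
      assume "q \<notin> Q0"
      then have "q \<in> Q1" using pq parts by auto
      then show False using n v(2)[of q p] pv sym[of v p] sym[of p q] \<open>p \<in> P0\<close> by auto
    qed
    moreover have "q0 \<noteq> q" using n q0(2) \<open>p \<in> P0\<close> by auto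
    moreover have "p \<noteq> u" using \<open>p \<in> P0\<close> u(1) parts by auto
    ultimately show False
      using no_W4[OF sg al, of p q x u q0] n P0D[of p] Q0D[of q] uD qD sub(3) qu uq0 q0(2)[of p]
        sym[of q0 p] inP[of p u] inQ[of q0 q] by auto
  qed
  show ?thesis
    by (rule pivot_across[OF sg clP clQ disj(1) _ _ _ _ _ uv _ _ A_def B_def])
      (use uD vD disj A B AB PQ P0D Q0D in auto)
qed

text \<open>For the pivot on \<open>xp\<close>, the rest of \<open>P0\<close> sees both ends,
  \<open>Q0\<close> sees only \<open>x\<close>, while \<open>P1\<close> and \<open>Q1\<close> see
  only \<open>p\<close>. So \<open>P0\<close> becomes complete to \<open>Q0\<close>,
  \<open>P1\<close> stays complete to \<open>Q1\<close>, and \<open>x\<close> inherits the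
  neighbours of \<open>p\<close>.\<close>

lemma extend_if_split_sets:
  assumes "\<And>p q. p \<in> P0 \<Longrightarrow> q \<in> Q0 \<Longrightarrow> \<not> h p q" "p \<in> P0" "\<And>q. q \<in> Q1 \<Longrightarrow> h p q"
  shows "two_cliques X h (P \<union> Q \<union> {x})"
proof -
  note pD = P0D[OF assms(2)]
  have xp: "h x p" and pX: "p \<in> X" "x \<noteq> p" using pD by auto
  let ?k = "piv h x p"
  have k: "sgraph ?k" by (rule sgraph_piv[OF sg])
  note pv = piv_iff[OF sg xp]
  have Q0p: "\<not> h q p" "\<not> h p q" if "q \<in> Q0" for q
    using assms(1)[OF assms(2) that] sym[of p q] by auto
  have Q1p: "h q p" "h p q" if "q \<in> Q1" for q
    using assms(3)[OF that] sym[of p q] by auto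
  have Pp: "h a p" "h p a" if "a \<in> P" "a \<noteq> p" for a
    using inP[of a p] inP[of p a] that pD by auto
  have P0: "clique_on ?k P0"
    unfolding clique_on_def
  proof (intro ballI impI)
    fix a b assume "a \<in> P0" "b \<in> P0" "a \<noteq> b"
    then show "?k a b"
      using pv[of a b] P0D[of a] P0D[of b] Pp[of a] Pp[of b] inP[of a b] by auto
  qed
  have Q0: "clique_on ?k Q0"
    unfolding clique_on_def
  proof (intro ballI impI)
    fix a b assume "a \<in> Q0" "b \<in> Q0" "a \<noteq> b"
    then show "?k a b"
      using pv[of a b] pD Q0D[of a] Q0D[of b] Q0p[of a] Q0p[of b] inQ[of a b] by auto
  qed
  have S: "clique_on ?k (P0 \<union> Q0)"
  proof (rule clique_on_Un[OF k P0 Q0])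
    fix a b assume "a \<in> P0" "b \<in> Q0" "a \<noteq> b"
    then show "?k a b"
      using pv[of a b] pD P0D[of a] Q0D[of b] Pp[of a] Q0p[of b] assms(1)[of a b] by auto
  qed
  have P1: "clique_on ?k P1"
    unfolding clique_on_def
  proof (intro ballI impI)
    fix a b assume "a \<in> P1" "b \<in> P1" "a \<noteq> b"
    then show "?k a b"
      using pv[of a b] pD P1D[of a] P1D[of b] Pp[of a] Pp[of b] inP[of a b] by auto
  qed
  have Q1: "clique_on ?k Q1"
    unfolding clique_on_def
  proof (intro ballI impI)
    fix a b assume "a \<in> Q1" "b \<in> Q1" "a \<noteq> b"
    then show "?k a b"
      using pv[of a b] pD Q1D[of a] Q1D[of b] Q1p[of a] Q1p[of b] inQ[of a b] by auto
  qed
  have "clique_on ?k (P1 \<union> Q1)"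
  proof (rule clique_on_Un[OF k P1 Q1])
    fix a b assume "a \<in> P1" "b \<in> Q1" "a \<noteq> b"
    then show "?k a b"
      using pv[of a b] pD P1D[of a] Q1D[of b] Pp[of a] Q1p[of b] P1Q1[of a b] by auto
  qed
  then have T: "clique_on ?k (insert x (P1 \<union> Q1))"
  proof (rule clique_on_insert[OF k])
    fix a assume "a \<in> P1 \<union> Q1"
    then show "?k x a"
      using pv[of x a] pD P1D[of a] Q1D[of a] Pp[of a] Q1p[of a] by auto
  qed
  show ?thesis
    by (rule two_cliquesI[OF orb_piv[of h, OF xp sub(3) pX(1)] S T]) (use parts in auto)
qed

text \<open>After pivoting \<open>x\<close> with \<open>p\<close> the vertices other than \<open>x\<close> are again covered by two cliques, and
  for one more pivot the hypotheses of \<open>pivot_twins\<close> are met.\<close>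

lemma extend_if_top:
  assumes p: "p \<in> P0" "\<And>q p'. q \<in> Q0 \<Longrightarrow> \<not> h p q \<Longrightarrow> p' \<in> P0 \<Longrightarrow> \<not> h p' q"
    and P1: "\<And>q p'. q \<in> Q0 \<Longrightarrow> h p q \<Longrightarrow> p' \<in> P1 \<Longrightarrow> \<not> h p' q"
    and Q1: "\<And>q. q \<in> Q1 \<Longrightarrow> \<not> h p q" and ne: "P1 \<noteq> {}" "Q1 \<noteq> {}"
    and tw: "(\<exists>q2\<in>Q0. \<exists>p2\<in>P0. (\<forall>p\<in>P1. h p q2) \<and> (\<forall>q\<in>Q1. h p2 q) \<and> (\<forall>q\<in>Q0. \<not> h p2 q)) \<or>
      (\<exists>u\<in>P1. \<exists>v\<in>Q1. (\<forall>q\<in>Q0. \<not> h u q) \<and> (\<forall>p\<in>P0. \<not> h p v))"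
  shows "two_cliques X h (P \<union> Q \<union> {x})"
proof -
  note pD = P0D[OF p(1)]
  have xp: "h x p" and pX: "p \<in> X" "x \<noteq> p" using pD by auto
  let ?k = "piv h x p"
  have k: "sgraph ?k" by (rule sgraph_piv[OF sg])
  have orb: "orb X h ?k" by (rule orb_piv[of h, OF xp sub(3) pX(1)])
  note pv = piv_iff[OF sg xp]
  define Qa where "Qa = {q\<in>Q0. h p q}"
  define Qb where "Qb = {q\<in>Q0. \<not> h p q}"
  have Q0: "Q0 = Qa \<union> Qb" by (auto simp: Qa_def Qb_def)
  have Pp: "h a p" "h p a" if "a \<in> P" "a \<noteq> p" for a
    using inP[of a p] inP[of p a] that pD by auto
  have Qa: "q \<in> Q" "h q x" "h x q" "h q p" "h p q" "q \<noteq> x" "q \<noteq> p" if "q \<in> Qa" for q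
    using that Q0D[of q] pD sym[of p q] by (auto simp: Qa_def)
  have Qb: "q \<in> Q" "h q x" "h x q" "\<not> h q p" "\<not> h p q" "q \<noteq> x" "q \<noteq> p" if "q \<in> Qb" for q
    using that Q0D[of q] pD sym[of p q] by (auto simp: Qb_def)
  have Q1': "q \<in> Q" "\<not> h q x" "\<not> h x q" "\<not> h q p" "\<not> h p q" "q \<noteq> x" "q \<noteq> p" if "q \<in> Q1" for q
    using that Q1D[of q] Q1[of q] pD sym[of p q] by auto
  have P1': "a \<in> P" "\<not> h a x" "\<not> h x a" "h a p" "h p a" "a \<noteq> x" "a \<noteq> p" if "a \<in> P1" for a
    using that P1D[of a] Pp[of a] pD by auto
  have P0': "a \<in> P" "h a x" "h x a" "a \<noteq> x" if "a \<in> P0" for a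
    using that P0D[of a] by auto
  have P0P1: "a \<noteq> b" if "a \<in> P0" "b \<in> P1" for a b
    using that P0D[of a] P1D[of b] by auto
  have QQ: "a \<noteq> b" if "a \<in> P" "b \<in> Q" for a b
    using that disj by auto
  have xQa: "?k x q" if "q \<in> Qa" for q using Qa[OF that] pv[of x q] by simp
  have xQb: "\<not> ?k x q" if "q \<in> Qb" for q using Qb[OF that] pv[of x q] by simp
  have xQ1: "\<not> ?k x q" if "q \<in> Q1" for q using Q1'[OF that] pv[of x q] by simp
  have xP1: "?k x a" if "a \<in> P1" for a using P1'[OF that] pv[of x a] by simp
  have xP0: "?k x a" if "a \<in> P0" for a using P0'[OF that] Pp[of a] pv[of x a] by auto
  have P0Q1: "?k a q \<longleftrightarrow> h a q" if "a \<in> P0" "q \<in> Q1" for a q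
    using that P0'[of a] Q1'[of q] Pp[of a] pv[of a q] QQ[of a q] by (cases "a = p") auto
  have P0P1': "\<not> ?k b a" if "a \<in> P0" "b \<in> P1" for a b
    using that P0'[of a] P1'[of b] Pp[of a] pv[of b a] P0P1[of a b] inP[of b a] by (cases "a = p") auto
  have P0Qb: "?k a q" if "a \<in> P0" "q \<in> Qb" for a q
    using that P0'[of a] Qb[of q] Pp[of a] pv[of a q] QQ[of a q] p(2)[of q a] Q0 by (cases "a = p") auto
  have P0Qa: "?k q a \<longleftrightarrow> h a q" if "a \<in> P0" "q \<in> Qa" "a \<noteq> p" for a q
    using that P0'[of a] Qa[of q] Pp[of a] pv[of q a] QQ[of a q] sym[of a q] by auto
  have P1Q1': "?k a q" if "a \<in> P1" "q \<in> Q1" for a q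
    using that P1'[of a] Q1'[of q] pv[of a q] QQ[of a q] P1Q1[of a q] by auto
  have P1Qa: "?k a q" if "a \<in> P1" "q \<in> Qa" for a q
    using that P1'[of a] Qa[of q] pv[of a q] QQ[of a q] P1[of q a] Q0 by auto
  have P1Qb: "?k a q \<longleftrightarrow> \<not> h a q" if "a \<in> P1" "q \<in> Qb" for a q
    using that P1'[of a] Qb[of q] pv[of a q] QQ[of a q] by auto
  have Q1Qa: "?k a q" if "a \<in> Q1" "q \<in> Qa" for a q
    using that Q1'[of a] Qa[of q] pv[of a q] inQ[of a q] by auto
  have Q1Qb: "?k a q" if "a \<in> Q1" "q \<in> Qb" for a q
    using that Q1'[of a] Qb[of q] pv[of a q] inQ[of a q] by auto
  have QaQb: "\<not> ?k a q" if "a \<in> Qa" "q \<in> Qb" for a q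
    using that Qa[of a] Qb[of q] pv[of a q] inQ[of a q] by auto
  have cP0: "clique_on ?k P0"
    unfolding clique_on_def
  proof (intro ballI impI)
    fix a b assume "a \<in> P0" "b \<in> P0" "a \<noteq> b"
    then show "?k a b"
      using pv[of a b] P0'[of a] P0'[of b] Pp[of a] Pp[of b] inP[of a b] by auto
  qed
  have cQb: "clique_on ?k Qb"
    unfolding clique_on_def
  proof (intro ballI impI)
    fix a b assume "a \<in> Qb" "b \<in> Qb" "a \<noteq> b"
    then show "?k a b" using pv[of a b] Qb[of a] Qb[of b] inQ[of a b] by auto
  qed
  have cQa: "clique_on ?k Qa"
    unfolding clique_on_def
  proof (intro ballI impI)
    fix a b assume "a \<in> Qa" "b \<in> Qa" "a \<noteq> b"
    then show "?k a b" using pv[of a b] Qa[of a] Qa[of b] inQ[of a b] by auto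
  qed
  have cQ1: "clique_on ?k Q1"
    unfolding clique_on_def
  proof (intro ballI impI)
    fix a b assume "a \<in> Q1" "b \<in> Q1" "a \<noteq> b"
    then show "?k a b" using pv[of a b] Q1'[of a] Q1'[of b] inQ[of a b] by auto
  qed
  have cP1: "clique_on ?k P1"
    unfolding clique_on_def
  proof (intro ballI impI)
    fix a b assume "a \<in> P1" "b \<in> P1" "a \<noteq> b"
    then show "?k a b" using pv[of a b] P1'[of a] P1'[of b] inP[of a b] by auto
  qed
  \<comment> \<open>Relative to \<open>xp\<close>, the rest of \<open>P0\<close> and
    \<open>Qa\<close> see both ends, \<open>Qb\<close> sees only \<open>x\<close>, \<open>P1\<close>
    only \<open>p\<close>, and \<open>Q1\<close> neither. Hence the absent edges between
    \<open>P0\<close> and \<open>Qb\<close> and between \<open>P1\<close> and \<open>Qa\<close>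
    appear, and \<open>Q1\<close> keeps its edges.\<close>
  let ?S = "P0 \<union> Qb" and ?T = "P1 \<union> (Q1 \<union> Qa)"
  have S: "clique_on ?k ?S"
    by (rule clique_on_Un[OF k cP0 cQb]) (use P0Qb in auto)
  have "clique_on ?k (Q1 \<union> Qa)"
    by (rule clique_on_Un[OF k cQ1 cQa]) (use Q1Qa in auto)
  then have T: "clique_on ?k ?T"
    by (rule clique_on_Un[OF k cP1]) (use P1Q1' P1Qa in auto)
  have ST: "?S \<inter> ?T = {}"
    using disj(1) by (auto simp: Qa_def Qb_def adj_def nonadj_def)
  have x: "x \<notin> ?S \<union> ?T" using Qa(6) Qb(6) Q1'(6) P1'(6) P0'(4) by blast
  have PQ: "?S \<union> ?T = P \<union> Q" using parts Q0 by auto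
  \<comment> \<open>After the pivot the chosen pair are twins: in the first alternative both see
    exactly \<open>Q1\<close> within \<open>?T\<close>, whereas \<open>x\<close> sees
    \<open>P1\<close> and \<open>Qa\<close>; in the second both see exactly \<open>Qb\<close> within
    \<open>?S\<close>, whereas \<open>x\<close> sees \<open>P0\<close>.\<close>
  from tw consider
    (1) q2 p2 where "q2 \<in> Q0" "p2 \<in> P0" "\<forall>p\<in>P1. h p q2" "\<forall>q\<in>Q1. h p2 q" "\<forall>q\<in>Q0. \<not> h p2 q"
    | (2) u v where "u \<in> P1" "v \<in> Q1" "\<forall>q\<in>Q0. \<not> h u q" "\<forall>p\<in>P0. \<not> h p v"
    by blast
  then have "two_cliques X ?k (P \<union> Q \<union> {x})"
  proof cases
    case 1
    have p2: "p2 \<noteq> p" using 1(4) Q1 ne by blast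
    have q2: "q2 \<in> Qb" using 1(1,3) P1[of q2] ne unfolding Qb_def by blast
    note p2D = P0D[OF 1(2)]
    have "two_cliques X ?k (?S \<union> ?T \<union> {x})"
    proof (rule pivot_twins[OF k S T ST x, of q2 p2])
      show "q2 \<in> ?S" "p2 \<in> ?S" using q2 1 by auto
      show "q2 \<noteq> p2" "q2 \<in> X" "p2 \<in> X" using p2D QQ[of p2 q2] Q0D[OF 1(1)] by auto
      show "\<not> ?k x q2" "?k x p2" using xQb[OF q2] xP0[OF 1(2)] by auto
    next
      fix c assume "c \<in> ?T"
      then consider "c \<in> P1" | "c \<in> Q1" | "c \<in> Qa" by blast
      then show "?k c q2 = ?k c p2" "?k x c = (\<not> ?k c q2)"
      proof (atomize (full), cases)
        case c: 1
        show "(?k c q2 = ?k c p2) \<and> (?k x c = (\<not> ?k c q2))"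
          using P1Qb[OF c q2] 1(3) c P0P1'[OF 1(2) c] xP1[OF c] by simp
      next
        case c: 2
        show "(?k c q2 = ?k c p2) \<and> (?k x c = (\<not> ?k c q2))"
          using Q1Qb[OF c q2] 1(4) c P0Q1[OF 1(2) c] sgraph_sym[OF k, of c p2] xQ1[OF c] by simp
      next
        case c: 3
        show "(?k c q2 = ?k c p2) \<and> (?k x c = (\<not> ?k c q2))"
          using QaQb[OF c q2] 1(5) c Q0 P0Qa[OF 1(2) c p2] xQa[OF c] by simp
      qed
    qed
    then show ?thesis using PQ by simp
  next
    case 2
    have "two_cliques X ?k (?T \<union> ?S \<union> {x})"
    proof (rule pivot_twins[OF k T S, of x v u])
      show "?T \<inter> ?S = {}" "x \<notin> ?T \<union> ?S" using ST x by auto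
      show "v \<in> ?T" "u \<in> ?T" using 2 by auto
      show "v \<noteq> u" "v \<in> X" "u \<in> X" using P1D[OF 2(1)] Q1D[OF 2(2)] by auto
      show "\<not> ?k x v" "?k x u" using xQ1[OF 2(2)] xP1[OF 2(1)] by auto
    next
      fix c assume "c \<in> ?S"
      then consider "c \<in> P0" | "c \<in> Qb" by blast
      then show "?k c v = ?k c u" "?k x c = (\<not> ?k c v)"
      proof (atomize (full), cases)
        case c: 1
        show "(?k c v = ?k c u) \<and> (?k x c = (\<not> ?k c v))"
          using P0Q1[OF c 2(2)] 2(4) c P0P1'[OF c 2(1)] sgraph_sym[OF k, of c u] xP0[OF c] by simp
      next
        case c: 2
        show "(?k c v = ?k c u) \<and> (?k x c = (\<not> ?k c v))"
          using P1Qb[OF 2(1) c] 2(3) c Q0 Q1Qb[OF 2(2) c] sgraph_sym[OF k, of c u]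
            sgraph_sym[OF k, of c v] xQb[OF c] by simp
      qed
    qed
    then show ?thesis using PQ by (simp add: Un_commute)
  qed
  then show ?thesis by (rule two_cliques_orb[OF orb])
qed

text \<open>In the first four cases the cliques are regrouped without a pivot. In
  \<open>rest\<close>, \<open>P0_uniform\<close> implies that no vertex of \<open>Q0\<close> has
  neighbours in both \<open>P0\<close> and \<open>P1\<close>, and no vertex of \<open>P0\<close> has
  neighbours in both \<open>Q0\<close> and \<open>Q1\<close>. The dichotomies for \<open>P1\<close>
  against \<open>Q0\<close> and for \<open>Q1\<close> against \<open>P0\<close> then leave four
  combinations.\<close>

lemma extend:
  "two_cliques X h (P \<union> Q \<union> {x})"
proof -
  interpret sw: two_cliques_vertex X h Q P x by (rule swap)
  have swapped: "two_cliques X h (Q \<union> P \<union> {x}) \<Longrightarrow> ?thesis" by (simp add: Un_commute)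
  have fin': "finite P1" "finite Q1" "finite Q0" using fin by (auto simp: nonadj_def adj_def)
  consider (P) "P1 = {}" | (Q) "Q1 = {}" | (A) "\<forall>a\<in>P0. \<forall>v\<in>Q1. h a v" | (B) "\<forall>b\<in>Q0. \<forall>u\<in>P1. h b u"
    | (I) "\<exists>q0\<in>Q0. \<exists>p\<in>P1. h p q0 \<and> (\<forall>p\<in>P0. h p q0)" "\<not> (\<forall>a\<in>P0. \<forall>v\<in>Q1. h a v)"
    | (I') "\<exists>p0\<in>P0. \<exists>q\<in>Q1. h q p0 \<and> (\<forall>q\<in>Q0. h q p0)" "\<not> (\<forall>b\<in>Q0. \<forall>u\<in>P1. h b u)"
    | (rest) "P1 \<noteq> {}" "Q1 \<noteq> {}" "\<not> (\<exists>q0\<in>Q0. \<exists>p\<in>P1. h p q0 \<and> (\<forall>p\<in>P0. h p q0))"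
      "\<not> (\<exists>p0\<in>P0. \<exists>q\<in>Q1. h q p0 \<and> (\<forall>q\<in>Q0. h q p0))"
    by blast
  then show ?thesis
  proof cases
    case P
    then have "clique_on h (insert x P)"
      using clique_on_insert[OF sg clP, of x] by (auto simp: nonadj_def)
    then show ?thesis by (rule two_cliquesI[OF orb_refl _ clQ]) auto
  next
    case Q
    then have "clique_on h (insert x Q)"
      using clique_on_insert[OF sg clQ, of x] by (auto simp: nonadj_def)
    then show ?thesis by (rule two_cliquesI[OF orb_refl clP]) auto
  next
    case A
    have "clique_on h Q1" by (rule clique_on_subset[OF clQ]) (auto simp: nonadj_def)
    then have 1: "clique_on h (P \<union> Q1)"
      by (rule clique_on_Un[OF sg clP]) (use A P1Q1 parts(1) in blast)
    have "clique_on h Q0" by (rule clique_on_subset[OF clQ]) (auto simp: adj_def)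
    then have 2: "clique_on h (insert x Q0)"
      by (rule clique_on_insert[OF sg]) (auto simp: adj_def)
    show ?thesis by (rule two_cliquesI[OF orb_refl 1 2]) (use parts(2) in auto)
  next
    case B
    have "clique_on h P1" by (rule clique_on_subset[OF clP]) (auto simp: nonadj_def)
    then have 1: "clique_on h (Q \<union> P1)"
      by (rule clique_on_Un[OF sg clQ]) (use B sw.P1Q1 parts(2) in blast)
    have "clique_on h P0" by (rule clique_on_subset[OF clP]) (auto simp: adj_def)
    then have 2: "clique_on h (insert x P0)"
      by (rule clique_on_insert[OF sg]) (auto simp: adj_def)
    show ?thesis by (rule two_cliquesI[OF orb_refl 1 2]) (use parts(1) in auto)
  next
    case I
    then obtain q0 p1 a0 v0 where "q0 \<in> Q0" "p1 \<in> P1" "h p1 q0" "\<forall>p\<in>P0. h p q0"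
      "a0 \<in> P0" "v0 \<in> Q1" "\<not> h a0 v0" by blast
    then show ?thesis using extend_if_full_vertex by metis
  next
    case I'
    then obtain q0 p1 a0 v0 where "q0 \<in> P0" "p1 \<in> Q1" "h p1 q0" "\<forall>p\<in>Q0. h p q0"
      "a0 \<in> Q0" "v0 \<in> P1" "\<not> h a0 v0" by blast
    then show ?thesis using sw.extend_if_full_vertex swapped by metis
  next
    case rest
    have nP: "\<not> h p1 q" if "q \<in> Q0" "p \<in> P0" "h p q" "p1 \<in> P1" for p q p1
    proof
      assume "h p1 q"
      then have "\<forall>p'\<in>P0. h p' q" using P0_uniform[OF that(4,1) _ _ that(2,3)] by blast
      then show False using rest(3) that \<open>h p1 q\<close> by blast
    qed
    have nQ: "\<not> h p q1" if "q \<in> Q0" "p \<in> P0" "h p q" "q1 \<in> Q1" for p q q1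
    proof
      assume "h p q1"
      then have s: "h q1 p" "h q p" using sym that by auto
      then have "\<forall>q'\<in>Q0. h q' p" using sw.P0_uniform[OF that(4,2) _ _ that(1)] by blast
      then show False using rest(4) that s by blast
    qed
    obtain p0 q0 where pq: "p0 \<in> P1" "q0 \<in> Q1" using rest by blast
    have a: "(\<exists>u\<in>P1. \<forall>q\<in>Q0. \<not> h u q) \<or> (\<exists>q2\<in>Q0. \<forall>p\<in>P1. h p q2)"
      by (rule nested_dichotomy[OF fin'(1) rest(1)]) (rule P1Q0_nested[OF pq(2)])
    have b: "(\<exists>v\<in>Q1. \<forall>p\<in>P0. \<not> h v p) \<or> (\<exists>p2\<in>P0. \<forall>q\<in>Q1. h q p2)"
      by (rule nested_dichotomy[OF fin'(2) rest(2)]) (rule sw.P1Q0_nested[OF pq(1)])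
    have b': "(\<exists>v\<in>Q1. \<forall>p\<in>P0. \<not> h p v) \<or> (\<exists>p2\<in>P0. \<forall>q\<in>Q1. h p2 q)"
      using b sym by metis
    have p2: "\<not> h p2 q" if "p2 \<in> P0" "\<forall>q\<in>Q1. h p2 q" "q \<in> Q0" for p2 q
      using nQ[OF that(3,1) _ pq(2)] that(2) pq(2) by blast
    have q2: "\<not> h p q2" if "q2 \<in> Q0" "\<forall>p\<in>P1. h p q2" "p \<in> P0" for q2 p
      using nP[OF that(1,3) _ pq(1)] that(2) pq(1) by blast
    have top: ?thesis
      if e: "\<exists>p\<in>P0. \<exists>q\<in>Q0. h p q"
        and tw: "(\<exists>q2\<in>Q0. \<exists>p2\<in>P0. (\<forall>p\<in>P1. h p q2) \<and> (\<forall>q\<in>Q1. h p2 q) \<and> (\<forall>q\<in>Q0. \<not> h p2 q)) \<or>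
          (\<exists>u\<in>P1. \<exists>v\<in>Q1. (\<forall>q\<in>Q0. \<not> h u q) \<and> (\<forall>p\<in>P0. \<not> h p v))"
    proof -
      \<comment> \<open>Keeping only vertices with a neighbour in \<open>P0\<close> rules out the
        first alternative of the dichotomy, so some \<open>p\<close> in \<open>P0\<close> has the
        largest neighbourhood in \<open>Q0\<close>.\<close>
      let ?Q = "{q\<in>Q0. \<exists>p\<in>P0. h p q}"
      have "(\<exists>q\<in>?Q. \<forall>p\<in>P0. \<not> h p q) \<or> (\<exists>p\<in>P0. \<forall>q\<in>?Q. h p q)"
      proof (rule nested_dichotomy)
        show "finite ?Q" "?Q \<noteq> {}" using fin' e by auto
      next
        fix a a' b b' assume "a \<in> ?Q" "a' \<in> ?Q" "b \<in> P0" "b' \<in> P0" "h b a" "h b' a'"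
        then show "h b' a \<or> h b a'" using P0Q0_nested[of b b' a a'] by auto
      qed
      then obtain p where p: "p \<in> P0" "\<forall>q\<in>?Q. h p q" by blast
      obtain q where q: "q \<in> Q0" "h p q" using e p by blast
      show ?thesis
      proof (rule extend_if_top[OF p(1) _ _ _ rest(1,2) tw])
        show "\<not> h p' q" if "q \<in> Q0" "\<not> h p q" "p' \<in> P0" for q p'
          using that p(2) by blast
        show "\<not> h p' q" if "q \<in> Q0" "h p q" "p' \<in> P1" for q p'
          using nP[OF that(1) p(1) that(2,3)] .
        show "\<not> h p q'" if "q' \<in> Q1" for q'
          using nQ[OF q(1) p(1) q(2) that] .
      qed
    qed
    consider (ab11) u p2 where "u \<in> P1" "\<forall>q\<in>Q0. \<not> h u q" "p2 \<in> P0" "\<forall>q\<in>Q1. h p2 q"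
      | (ab22) v q2 where "v \<in> Q1" "\<forall>p\<in>P0. \<not> h p v" "q2 \<in> Q0" "\<forall>p\<in>P1. h p q2"
      | (ab12) u v where "u \<in> P1" "\<forall>q\<in>Q0. \<not> h u q" "v \<in> Q1" "\<forall>p\<in>P0. \<not> h p v"
      | (ab21) q2 p2 where "q2 \<in> Q0" "\<forall>p\<in>P1. h p q2" "p2 \<in> P0" "\<forall>q\<in>Q1. h p2 q"
      using a b' by blast
    then show ?thesis
    proof cases
      case ab11
      \<comment> \<open>Within \<open>Q\<close>, both \<open>u\<close> and \<open>p2\<close> see
        exactly \<open>Q1\<close>, and \<open>x\<close> sees exactly \<open>Q0\<close>.\<close>
      note uD = P1D[OF ab11(1)] and pD = P0D[OF ab11(3)]
      show ?thesis
      proof (rule pivot_twins[OF sg clP clQ, of x u p2])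
        fix c assume "c \<in> Q"
        then consider "c \<in> Q0" | "c \<in> Q1" using parts by blast
        then show "h c u = h c p2" "h x c = (\<not> h c u)"
          using ab11(2,4) p2[OF ab11(3,4), of c] P1Q1[OF ab11(1), of c] sym[of c u] sym[of c p2]
            Q0D[of c] Q1D[of c] by (atomize (full), cases) auto
      qed (use uD pD disj in auto)
    next
      case ab22
      note uD = Q1D[OF ab22(1)] and pD = Q0D[OF ab22(3)]
      have "two_cliques X h (Q \<union> P \<union> {x})"
      proof (rule pivot_twins[OF sg clQ clP, of x v q2])
        fix c assume "c \<in> P"
        then consider "c \<in> P0" | "c \<in> P1" using parts by blast
        then show "h c v = h c q2" "h x c = (\<not> h c v)"
          using ab22(2,4) q2[OF ab22(3,4), of c] P1Q1[of c, OF _ ab22(1)]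
            P0D[of c] P1D[of c] by (atomize (full), cases) auto
      qed (use uD pD disj in auto)
      then show ?thesis by (rule swapped)
    next
      case ab12
      note uD = P1D[OF ab12(1)] and vD = Q1D[OF ab12(3)]
      show ?thesis
      proof (cases "\<exists>p\<in>P0. \<exists>q\<in>Q0. h p q")
        case True
        show ?thesis by (rule top[OF True]) (use ab12 in blast)
      next
        case False
        define A where "A = {p\<in>P. \<not> h p v}"
        define B where "B = {q\<in>Q. \<not> h q u}"
        have AP: "A = P0"
          using ab12(4) P1Q1[OF _ ab12(3)] parts by (auto simp: A_def)
        have BQ: "B = Q0"
          using ab12(2) P1Q1[OF ab12(1)] parts(2,4) sym[of u] by (auto simp: B_def)
        show ?thesis
        proof (rule pivot_across[OF sg clP clQ disj(1) _ _ _ _ _ P1Q1[OF ab12(1,3)] _ _ A_def B_def])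
          show "h p q" if "p \<in> P - A" "q \<in> Q - B" for p q
            using that AP BQ parts P1Q1[of p q] by blast
        qed (use uD vD disj AP BQ False P0D Q0D in auto)
      qed
    next
      case ab21
      show ?thesis
      proof (cases "\<exists>p\<in>P0. \<exists>q\<in>Q0. h p q")
        case True
        show ?thesis by (rule top[OF True]) (use ab21 p2 in blast)
      next
        case False
        then show ?thesis using extend_if_split_sets[OF _ ab21(3)] ab21(4) by blast
      qed
    qed
  qed
qed

end

section \<open>Vertex orderings\<close>

text \<open>The edges of \<open>R\<close> across the cut \<open>S\<close> are then the full
  rectangle of \<open>B \<inter> S\<close> and \<open>A - S\<close>.\<close>

definition chain_cut :: "('a \<Rightarrow> 'a \<Rightarrow> bool) \<Rightarrow> 'a set \<Rightarrow> 'a set \<Rightarrow> 'a set \<Rightarrow> bool" where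
  "chain_cut R A B S \<longleftrightarrow> (\<forall>a\<in>A \<inter> S. \<forall>b\<in>B - S. \<not> R a b) \<and> (\<forall>b\<in>B \<inter> S. \<forall>a\<in>A - S. R a b)"

text \<open>By \<open>nested_dichotomy\<close> some vertex may always be listed next: one of
  \<open>A\<close> with no neighbours left in \<open>B\<close>, or one of \<open>B\<close> adjacent
  to everything left in \<open>A\<close>.\<close>

lemma chain_ordering:
  assumes "finite A" "finite B" "A \<inter> B = {}"
    and "\<And>a a' b b'. a \<in> A \<Longrightarrow> a' \<in> A \<Longrightarrow> b \<in> B \<Longrightarrow> b' \<in> B \<Longrightarrow> R a b \<Longrightarrow> R a' b' \<Longrightarrow> R a b' \<or> R a' b"
  shows "\<exists>xs. distinct xs \<and> set xs = A \<union> B \<and> (\<forall>i. chain_cut R A B (set (take i xs)))"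
  using assms
proof (induction "card A + card B" arbitrary: A B rule: less_induct)
  case less
  note fin = less.prems(1,2) and disj = less.prems(3) and nested = less.prems(4)
  show ?case
  proof (cases "A = {}")
    case True
    obtain xs where "set xs = B" "distinct xs" using finite_distinct_list[OF fin(2)] by blast
    then show ?thesis using True by (intro exI[of _ xs]) (simp add: chain_cut_def)
  next
    case False
    have "(\<exists>u\<in>A. \<forall>b\<in>B. \<not> R u b) \<or> (\<exists>b\<in>B. \<forall>a\<in>A. R a b)"
      by (rule nested_dichotomy[OF fin(1) False]) (rule nested)
    then consider u where "u \<in> A" "\<forall>b\<in>B. \<not> R u b" | b where "b \<in> B" "\<forall>a\<in>A. R a b"
      by blast
    then show ?thesis
    proof cases
      case 1
      have "\<exists>xs. distinct xs \<and> set xs = (A - {u}) \<union> B \<and> (\<forall>i. chain_cut R (A - {u}) B (set (take i xs)))"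
      proof (rule less.hyps)
        show "card (A - {u}) + card B < card A + card B"
          using card_Diff1_less[OF fin(1) 1(1)] by simp
        show "R a b' \<or> R a' b"
          if "a \<in> A - {u}" "a' \<in> A - {u}" "b \<in> B" "b' \<in> B" "R a b" "R a' b'" for a a' b b'
          using nested[of a a' b b'] that by simp
      qed (use fin disj in auto)
      then obtain xs where xs: "distinct xs" "set xs = (A - {u}) \<union> B"
        "\<forall>i. chain_cut R (A - {u}) B (set (take i xs))"
        by blast
      have "chain_cut R A B (set (take i (u # xs)))" for i
      proof (cases i)
        case (Suc j)
        have c: "chain_cut R (A - {u}) B (set (take j xs))" using xs(3) by blast
        show ?thesis
          using c 1 disj by (simp add: Suc chain_cut_def) blast
      qed (simp add: chain_cut_def)
      then show ?thesis
        using xs(1,2) 1(1) disj by (intro exI[of _ "u # xs"]) auto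
    next
      case 2
      have "\<exists>xs. distinct xs \<and> set xs = A \<union> (B - {b}) \<and> (\<forall>i. chain_cut R A (B - {b}) (set (take i xs)))"
      proof (rule less.hyps)
        show "card A + card (B - {b}) < card A + card B"
          using card_Diff1_less[OF fin(2) 2(1)] by simp
        show "R a c' \<or> R a' c"
          if "a \<in> A" "a' \<in> A" "c \<in> B - {b}" "c' \<in> B - {b}" "R a c" "R a' c'" for a a' c c'
          using nested[of a a' c c'] that by simp
      qed (use fin disj in auto)
      then obtain xs where xs: "distinct xs" "set xs = A \<union> (B - {b})"
        "\<forall>i. chain_cut R A (B - {b}) (set (take i xs))"
        by blast
      have "chain_cut R A B (set (take i (b # xs)))" for i
      proof (cases i)
        case (Suc j)
        have c: "chain_cut R A (B - {b}) (set (take j xs))" using xs(3) by blast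
        show ?thesis
          using c 2 disj by (simp add: Suc chain_cut_def) blast
      qed (simp add: chain_cut_def)
      then show ?thesis
        using xs(1,2) 2(1) disj by (intro exI[of _ "b # xs"]) auto
    qed
  qed
qed

text \<open>Weaker than \<open>chain_cut\<close>: the rectangle need not fill the whole cut, which
  leaves room for other components on either side. The matrix of \<open>R\<close> across the cut has
  rank at most one.\<close>

definition rect_cut :: "('a \<Rightarrow> 'a \<Rightarrow> bool) \<Rightarrow> 'a set \<Rightarrow> 'a set \<Rightarrow> 'a set \<Rightarrow> bool" where
  "rect_cut R P Q S \<longleftrightarrow> (\<forall>p\<in>P \<inter> S. \<forall>q\<in>Q - S. \<not> R p q) \<and>
     (\<exists>A B. \<forall>q\<in>Q \<inter> S. \<forall>p\<in>P - S. R p q \<longleftrightarrow> p \<in> A \<and> q \<in> B)"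

lemma rect_cutI:
  assumes "\<And>p q. p \<in> P \<inter> S \<Longrightarrow> q \<in> Q - S \<Longrightarrow> \<not> R p q"
    and "\<And>p q. q \<in> Q \<inter> S \<Longrightarrow> p \<in> P - S \<Longrightarrow> R p q \<longleftrightarrow> p \<in> A \<and> q \<in> B"
  shows "rect_cut R P Q S"
  unfolding rect_cut_def using assms by (intro conjI exI[of _ A] exI[of _ B] ballI)

text \<open>The hypotheses exclude paths with middle vertex in \<open>P\<close> and in
  \<open>Q\<close>, respectively. A vertex \<open>q\<close> of largest degree has \<open>C\<close>
  and \<open>D\<close> as its component, and \<open>C\<close> against \<open>D\<close> is nested
  because two offending edges are linked through \<open>q\<close> to such a path. Whole components
  are listed in turn, so at most one is cut.\<close>

lemma P5_free_ordering:
  assumes "finite P" "finite Q" "P \<inter> Q = {}"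
    and "\<And>p1 p p2 q1 q2. {p1, p, p2} \<subseteq> P \<Longrightarrow> {q1, q2} \<subseteq> Q \<Longrightarrow>
      R p1 q1 \<Longrightarrow> R p q1 \<Longrightarrow> R p q2 \<Longrightarrow> R p2 q2 \<Longrightarrow> R p1 q2 \<or> R p2 q1"
    and "\<And>q1 q q2 p1 p2. {q1, q, q2} \<subseteq> Q \<Longrightarrow> {p1, p2} \<subseteq> P \<Longrightarrow>
      R p1 q1 \<Longrightarrow> R p1 q \<Longrightarrow> R p2 q \<Longrightarrow> R p2 q2 \<Longrightarrow> R p1 q2 \<or> R p2 q1"
  shows "\<exists>xs. distinct xs \<and> set xs = P \<union> Q \<and> (\<forall>i. rect_cut R P Q (set (take i xs)))"
  using assms
proof (induction "card P" arbitrary: P Q rule: less_induct)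
  case less
  note fin = less.prems(1,2) and disj = less.prems(3) and L1 = less.prems(4) and L2 = less.prems(5)
  show ?case
  proof (cases "\<exists>p\<in>P. \<exists>q\<in>Q. R p q")
    case False
    obtain xs where "set xs = P \<union> Q" "distinct xs" using finite_distinct_list[of "P \<union> Q"] fin by auto
    moreover have "rect_cut R P Q S" for S
      by (rule rect_cutI[of _ _ _ _ "{}" "{}"]) (use False in auto)
    ultimately show ?thesis by blast
  next
    case True
    let ?N = "\<lambda>q. {p\<in>P. R p q}"
    have N: "finite (?N q)" for q using fin by simp
    obtain p0 q0 where pq: "p0 \<in> P" "q0 \<in> Q" "R p0 q0" using True by blast
    obtain q where q: "q \<in> Q" "\<And>q'. q' \<in> Q \<Longrightarrow> card (?N q') \<le> card (?N q)"
    proof -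
      have "Max ((\<lambda>q. card (?N q)) ` Q) \<in> (\<lambda>q. card (?N q)) ` Q"
        by (rule Max_in) (use fin(2) pq(2) in auto)
      then obtain q where "q \<in> Q" "Max ((\<lambda>q. card (?N q)) ` Q) = card (?N q)" by blast
      then show thesis
        using that[of q] Max_ge[of "(\<lambda>q. card (?N q)) ` Q"] fin(2) by auto
    qed
    have "?N q0 \<noteq> {}" using pq by blast
    then have "0 < card (?N q0)" using N[of q0] by (simp only: card_gt_0_iff simp_thms)
    then have "0 < card (?N q)" using q(2)[OF pq(2)] by (rule less_le_trans)
    then have ne: "?N q \<noteq> {}" by (simp only: card_gt_0_iff simp_thms)
    define C where "C = ?N q"
    define D where "D = {q'\<in>Q. \<exists>p\<in>C. R p q'}"
    have CP: "C \<subseteq> P" and DQ: "D \<subseteq> Q" by (auto simp: C_def D_def)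
    \<comment> \<open>Otherwise the paths \<open>p q' p' q c\<close> make \<open>q'\<close> adjacent
      to every \<open>c\<close> in \<open>C\<close> and to \<open>p\<close> besides, against the
      maximal degree of \<open>q\<close>.\<close>
    have out: "p \<in> C" if o: "p \<in> P" "q' \<in> D" "R p q'" for p q'
    proof (rule ccontr)
      assume n: "p \<notin> C"
      obtain p' where p': "p' \<in> C" "R p' q'" using o(2) by (auto simp: D_def)
      have "R c q'" if "c \<in> C" for c
        using L1[of p p' c q' q] \<open>p \<in> P\<close> \<open>R p q'\<close> \<open>q' \<in> D\<close> p' that n q(1) by (auto simp: C_def D_def)
      then have "insert p C \<subseteq> ?N q'" using o by (auto simp: C_def)
      then have "card (insert p C) \<le> card (?N q')" by (rule card_mono[OF N])
      moreover have "card (insert p C) = Suc (card C)" using n N[of q] by (simp add: C_def)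
      moreover have "card (?N q') \<le> card C" using q(2)[of q'] o(2) by (simp add: C_def D_def)
      ultimately show False by simp
    qed
    have nested: "R a b' \<or> R a' b" if "a \<in> C" "a' \<in> C" "b \<in> D" "b' \<in> D" "R a b" "R a' b'" for a a' b b'
      using L2[of b q b' a a'] that q(1) by (auto simp: C_def D_def)
    have finCD: "finite C" "finite D" using fin by (auto simp: C_def D_def)
    have CD: "C \<inter> D = {}" using disj CP DQ by auto
    have "\<exists>xs. distinct xs \<and> set xs = C \<union> D \<and> (\<forall>i. chain_cut R C D (set (take i xs)))"
      by (rule chain_ordering[OF finCD CD]) (rule nested)
    then obtain xs where xs: "distinct xs" "set xs = C \<union> D" "\<forall>i. chain_cut R C D (set (take i xs))"
      by blast
    have chain: "\<not> R a b" if "a \<in> C" "a \<in> set (take i xs)" "b \<in> D" "b \<notin> set (take i xs)" for i a b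
      using xs(3) that unfolding chain_cut_def by blast
    have chain': "R a b" if "b \<in> D" "b \<in> set (take i xs)" "a \<in> C" "a \<notin> set (take i xs)" for i a b
      using xs(3) that unfolding chain_cut_def by blast
    have c: "card (P - C) < card P"
      using CP ne finCD fin(1) by (intro psubset_card_mono) (auto simp: C_def)
    obtain ys where ys: "distinct ys" "set ys = (P - C) \<union> (Q - D)"
      "\<And>i. rect_cut R (P - C) (Q - D) (set (take i ys))"
    proof -
      have "\<exists>ys. distinct ys \<and> set ys = (P - C) \<union> (Q - D) \<and> (\<forall>i. rect_cut R (P - C) (Q - D) (set (take i ys)))"
      proof (rule less.hyps[OF c])
        show "R p1 q2 \<or> R p2 q1" if "{p1, p, p2} \<subseteq> P - C" "{q1, q2} \<subseteq> Q - D"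
          "R p1 q1" "R p q1" "R p q2" "R p2 q2" for p1 p p2 q1 q2
          using L1[of p1 p p2 q1 q2] that by auto
        show "R p1 q2 \<or> R p2 q1" if "{q1, q, q2} \<subseteq> Q - D" "{p1, p2} \<subseteq> P - C"
          "R p1 q1" "R p1 q" "R p2 q" "R p2 q2" for q1 q q2 p1 p2
          using L2[of q1 q q2 p1 p2] that by auto
      qed (use fin disj in auto)
      then show thesis using that by (elim exE conjE) (simp only: simp_thms)
    qed
    have out': "\<not> R p q'" if "p \<in> C" "q' \<in> Q - D" for p q'
      using that by (auto simp: D_def)
    have "rect_cut R P Q (set (take i (xs @ ys)))" for i
    proof (cases "i \<le> length xs")
      case True
      let ?S = "set (take i xs)"
      have S: "?S \<subseteq> C \<union> D" using xs(2) set_take_subset[of i xs] by simp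
      have 1: "\<not> R p q'" if "p \<in> P \<inter> ?S" "q' \<in> Q - ?S" for p q'
      proof -
        have "p \<in> C" using that S DQ disj by auto
        then show ?thesis using chain[of p i q'] out'[of p q'] that by auto
      qed
      have 2: "R p q' \<longleftrightarrow> p \<in> C \<and> q' \<in> D" if "q' \<in> Q \<inter> ?S" "p \<in> P - ?S" for p q'
      proof -
        have "q' \<in> D" using that S CP disj by auto
        then show ?thesis using chain'[of q' i p] out[of p q'] that by auto
      qed
      have "rect_cut R P Q ?S" by (rule rect_cutI[OF 1 2])
      then show ?thesis using True by simp
    next
      case False
      let ?S' = "set (take (i - length xs) ys)"
      have S: "set (take i (xs @ ys)) = C \<union> D \<union> ?S'" using False xs(2) by simp
      obtain A B where AB: "\<forall>p\<in>(P - C) \<inter> ?S'. \<forall>q\<in>(Q - D) - ?S'. \<not> R p q"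
        "\<forall>q\<in>(Q - D) \<inter> ?S'. \<forall>p\<in>(P - C) - ?S'. R p q \<longleftrightarrow> p \<in> A \<and> q \<in> B"
        using ys(3)[of "i - length xs"] unfolding rect_cut_def by (elim conjE exE)
      have 1: "\<not> R p q'" if "p \<in> P \<inter> (C \<union> D \<union> ?S')" "q' \<in> Q - (C \<union> D \<union> ?S')" for p q'
      proof (cases "p \<in> C")
        case True
        then show ?thesis using out'[of p q'] that by simp
      next
        case False
        then have "p \<in> (P - C) \<inter> ?S'" using that(1) DQ disj by blast
        moreover have "q' \<in> (Q - D) - ?S'" using that(2) by simp
        ultimately show ?thesis using AB(1) by simp
      qed
      \<comment> \<open>\<open>B\<close> is unconstrained on \<open>D\<close>, whose vertices have
        no neighbours beyond the cut; hence \<open>D\<close> is removed from the rectangle.\<close>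
      have 2: "R p q' \<longleftrightarrow> p \<in> A \<and> q' \<in> B - D"
        if "q' \<in> Q \<inter> (C \<union> D \<union> ?S')" "p \<in> P - (C \<union> D \<union> ?S')" for p q'
      proof (cases "q' \<in> D")
        case True
        then show ?thesis using out[of p q'] that(2) by auto
      next
        case False
        then have "q' \<in> (Q - D) \<inter> ?S'" using that(1) CP disj by blast
        moreover have "p \<in> (P - C) - ?S'" using that(2) by simp
        ultimately show ?thesis using AB(2) False by simp
      qed
      show ?thesis unfolding S by (rule rect_cutI[OF 1 2])
    qed
    then show ?thesis
      using xs(1,2) ys(1,2) CP DQ disj by (intro exI[of _ "xs @ ys"]) auto
  qed
qed

text \<open>A row from \<open>P\<close> is the indicator of \<open>P - S\<close>. A row from
  \<open>Q\<close> is the indicator of \<open>Q - S\<close>, plus that of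
  \<open>A \<inter> P - S\<close> if the row belongs to \<open>B\<close>.\<close>

lemma cut_le_rect_cut:
  assumes "sgraph h" "clique_on h P" "clique_on h Q" "P \<inter> Q = {}" "S \<subseteq> P \<union> Q" "rect_cut h P Q S"
  shows "cut_le 3 h S (P \<union> Q - S)"
proof -
  obtain A B where c: "\<forall>p\<in>P \<inter> S. \<forall>q\<in>Q - S. \<not> h p q"
    "\<forall>q\<in>Q \<inter> S. \<forall>p\<in>P - S. h p q \<longleftrightarrow> p \<in> A \<and> q \<in> B"
    using assms(6) unfolding rect_cut_def by (elim conjE exE)
  define i :: "'a set \<Rightarrow> 'a \<Rightarrow> bit" where "i = (\<lambda>T c. if c \<in> T then 1 else (0 :: bit))"
  let ?V = "{i (P - S), i (Q - S), i (A \<inter> P - S)}"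
  have V: "i (P - S) \<in> bit_fun.span ?V" "i (Q - S) \<in> bit_fun.span ?V" "i (A \<inter> P - S) \<in> bit_fun.span ?V"
    by (rule bit_fun.span_base, simp)+
  have "(\<lambda>c. if c \<in> P \<union> Q - S \<and> h r c then 1 else 0) \<in> bit_fun.span ?V" if r: "r \<in> S" for r
  proof (cases "r \<in> P")
    case True
    have "c \<in> P \<union> Q - S \<and> h r c \<longleftrightarrow> c \<in> P - S" for c
      using r True bspec[OF bspec[OF c(1)], of r c] clique_onD[OF assms(2), of r c] by auto
    then have "(\<lambda>c. if c \<in> P \<union> Q - S \<and> h r c then 1 else 0) = i (P - S)"
      unfolding i_def by (simp only:)
    then show ?thesis using V(1) by (simp only:)
  next
    case False
    then have rQ: "r \<in> Q" using r assms(5) by auto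
    have row: "c \<in> P \<union> Q - S \<and> h r c \<longleftrightarrow> c \<in> Q - S \<or> c \<in> A \<inter> P - S \<and> r \<in> B" for c
      using r rQ bspec[OF bspec[OF c(2)], of r c] clique_onD[OF assms(3), of r c]
        sgraph_sym[OF assms(1), of r c] by auto
    show ?thesis
    proof (cases "r \<in> B")
      case True
      have "(\<lambda>c. if c \<in> P \<union> Q - S \<and> h r c then 1 else 0) = i (Q - S) + i (A \<inter> P - S)"
        unfolding row i_def using True assms(4) by (auto simp: fun_eq_iff)
      then show ?thesis using bit_fun.span_add[OF V(2,3)] by (simp only:)
    next
      case False
      then have "(\<lambda>c. if c \<in> P \<union> Q - S \<and> h r c then 1 else 0) = i (Q - S)"
        unfolding row i_def by simp
      then show ?thesis using V(2) by (simp only:)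
    qed
  qed
  then have "bip_rows h S (P \<union> Q - S) \<subseteq> bit_fun.span ?V"
    unfolding bip_rows_def by (rule image_subsetI)
  moreover have "card {a, b, c} \<le> 3" for a b c :: "'a \<Rightarrow> bit"
    by (simp add: card_insert_if)
  ultimately show ?thesis unfolding cut_le_def by (intro exI[of _ ?V] conjI) simp_all
qed

section \<open>Orderings of connected and of arbitrary graphs\<close>

definition narrow_ordering :: "'a set \<Rightarrow> ('a \<Rightarrow> 'a \<Rightarrow> bool) \<Rightarrow> 'a list \<Rightarrow> bool" where
  "narrow_ordering X g xs \<longleftrightarrow> distinct xs \<and> set xs = X \<and>
     (\<forall>i. cut_le 3 g (set (take i xs)) (X - set (take i xs)))"

lemma narrow_ordering_connected:
  assumes "finite X" "sgraph g" "orb_claw_free X g" "connected_on X g"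
  shows "\<exists>xs. narrow_ordering X g xs"
proof -
  have al: "orb_alpha2 X g" by (rule orb_alpha2I[OF assms(2-4)])
  let ?F = "{S. S \<subseteq> X \<and> two_cliques X g S}"
  have "two_cliques X g {}"
    by (rule two_cliquesI[OF orb_refl, of _ "{}" "{}"]) (auto simp: clique_on_def)
  moreover have "finite ?F" using assms(1) by simp
  ultimately obtain S where S: "S \<in> ?F" "\<And>T. T \<in> ?F \<Longrightarrow> S \<subseteq> T \<Longrightarrow> S = T"
    using finite_has_maximal[of ?F] by auto
  obtain h A B where h: "orb X g h" "A \<union> B = S" "clique_on h A" "clique_on h B"
    using S(1) by (auto simp: two_cliques_def)
  define Q where "Q = B - A"
  have Q: "clique_on h Q" "A \<union> Q = S" "A \<inter> Q = {}"
    using h clique_on_subset[OF h(4), of Q] by (auto simp: Q_def)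
  have sg: "sgraph h" and alh: "orb_alpha2 X h"
    using orb_sgraph[OF h(1) assms(2)] orb_alpha2_orb[OF al h(1)] .
  have sub: "A \<subseteq> X" "Q \<subseteq> X" using S(1) Q(2) by auto
  have fin: "finite A" "finite Q" using sub assms(1) by (auto intro: finite_subset)
  have "S = X"
  proof (rule ccontr)
    assume "S \<noteq> X"
    then obtain x where x: "x \<in> X" "x \<notin> S" using S(1) by auto
    have "two_cliques_vertex X h A Q x"
      by unfold_locales (use sg alh sub x Q h(3) fin in auto)
    then have "two_cliques X h (A \<union> Q \<union> {x})" by (rule two_cliques_vertex.extend)
    then have "two_cliques X g (insert x S)" using two_cliques_orb[OF h(1)] Q(2) by simp
    then show False using S(2)[of "insert x S"] S(1) x by auto
  qed
  then have X: "X = A \<union> Q" using Q(2) by simp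
  have A: "h a b" if "a \<in> A" "b \<in> A" "a \<noteq> b" for a b using clique_onD[OF h(3) that] .
  have B: "h a b" if "a \<in> Q" "b \<in> Q" "a \<noteq> b" for a b using clique_onD[OF Q(1) that] .
  obtain xs where xs: "distinct xs" "set xs = A \<union> Q" "\<And>i. rect_cut h A Q (set (take i xs))"
  proof -
    have "\<exists>xs. distinct xs \<and> set xs = A \<union> Q \<and> (\<forall>i. rect_cut h A Q (set (take i xs)))"
    proof (rule P5_free_ordering[OF fin Q(3)])
      fix p1 p p2 q1 q2 assume a: "{p1, p, p2} \<subseteq> A" "{q1, q2} \<subseteq> Q" "h p1 q1" "h p q1" "h p q2" "h p2 q2"
      show "h p1 q2 \<or> h p2 q1"
      proof (rule ccontr)
        assume n: "\<not> ?thesis"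
        \<comment> \<open>The cliques close the path without its middle vertex to the four-cycle
          \<open>p1 p2 q2 q1\<close>, with the middle vertex \<open>p\<close> as hub.\<close>
        have "p1 \<noteq> p2" "q1 \<noteq> q2" "p \<noteq> p1" "p \<noteq> p2" "p1 \<noteq> q2" "p2 \<noteq> q1" using n a Q(3) by auto
        then show False
          using no_W4[OF sg alh, of p1 q2 p2 q1 p] a n sub A[of p1 p2] A[of p p1] A[of p p2] B[of q2 q1]
            sgraph_sym[OF sg, of q2 p2] by auto
      qed
    next
      fix q1 q q2 p1 p2 assume a: "{q1, q, q2} \<subseteq> Q" "{p1, p2} \<subseteq> A" "h p1 q1" "h p1 q" "h p2 q" "h p2 q2"
      show "h p1 q2 \<or> h p2 q1"
      proof (rule ccontr)
        assume n: "\<not> ?thesis"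
        have "p1 \<noteq> p2" "q1 \<noteq> q2" "q \<noteq> q1" "q \<noteq> q2" "p1 \<noteq> q2" "p2 \<noteq> q1" using n a Q(3) by auto
        then show False
          using no_W4[OF sg alh, of p1 q2 p2 q1 q] a n sub A[of p1 p2] B[of q q1] B[of q q2] B[of q2 q1]
            sgraph_sym[OF sg, of q2 p2] sgraph_sym[OF sg, of q p1] sgraph_sym[OF sg, of q p2] by auto
      qed
    qed
    then show thesis using that by blast
  qed
  have "cut_le 3 g (set (take i xs)) (X - set (take i xs))" for i
  proof -
    have s: "set (take i xs) \<subseteq> A \<union> Q" using xs(2) set_take_subset[of i xs] by simp
    show ?thesis
      using cut_le_rect_cut[OF sg h(3) Q(1,3) s xs(3)] cut_le_orb[OF h(1) assms(2), of "set (take i xs)" 3] X s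
      by simp
  qed
  then show ?thesis using xs X unfolding narrow_ordering_def by blast
qed

lemma orb_claw_free_subset:
  assumes "orb_claw_free X g" "Y \<subseteq> X"
  shows "orb_claw_free Y g"
  unfolding orb_claw_free_def
proof (intro allI impI)
  fix h assume "orb Y g h"
  then have "orb X g h" by (rule orb_mono[OF _ assms(2)])
  then have "claw_free X h" using assms(1) by (simp add: orb_claw_free_def)
  then show "claw_free Y h" using assms(2) unfolding claw_free_def by blast
qed

text \<open>Orderings of the two sides of an edgeless split are concatenated: across any cut, the
  side that is not being cut contributes only zero columns or zero rows.\<close>

lemma narrow_ordering_exists:
  assumes "finite X" "sgraph g" "orb_claw_free X g"
  shows "\<exists>xs. narrow_ordering X g xs"
  using assms
proof (induction "card X" arbitrary: X rule: less_induct)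
  case less
  show ?case
  proof (cases "connected_on X g")
    case True
    then show ?thesis using narrow_ordering_connected less.prems by blast
  next
    case False
    then obtain Y where Y: "Y \<subseteq> X" "Y \<noteq> {}" "Y \<noteq> X" and no: "\<And>y z. y \<in> Y \<Longrightarrow> z \<in> X - Y \<Longrightarrow> \<not> g y z"
      unfolding connected_on_def by blast
    let ?Z = "X - Y"
    have "card Y < card X" using Y less.prems(1) by (intro psubset_card_mono) auto
    then obtain ys where ys: "narrow_ordering Y g ys"
      using less.hyps[of Y] Y(1) less.prems orb_claw_free_subset finite_subset by metis
    have "card ?Z < card X" using Y less.prems(1) by (intro psubset_card_mono) auto
    then obtain zs where zs: "narrow_ordering ?Z g zs"
      using less.hyps[of ?Z] less.prems orb_claw_free_subset[of X g ?Z] by auto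
    have "cut_le 3 g (set (take i (ys @ zs))) (X - set (take i (ys @ zs)))" for i
    proof (cases "i \<le> length ys")
      case True
      let ?S = "set (take i ys)"
      have S: "?S \<subseteq> Y" using ys set_take_subset[of i ys] by (auto simp: narrow_ordering_def)
      have "bip_rows g ?S (X - ?S) = bip_rows g ?S (Y - ?S)"
        unfolding bip_rows_def by (rule image_cong[OF HOL.refl], rule ext) (use S no Y(1) in auto)
      moreover have "cut_le 3 g ?S (Y - ?S)" using ys by (simp add: narrow_ordering_def)
      ultimately show ?thesis using True by (simp add: cut_le_def)
    next
      case False
      let ?S = "set (take (i - length ys) zs)"
      have S: "set (take i (ys @ zs)) = Y \<union> ?S" using False ys by (simp add: narrow_ordering_def)
      have SZ: "?S \<subseteq> ?Z" using zs set_take_subset[of "i - length ys" zs] by (auto simp: narrow_ordering_def)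
      obtain B where B: "finite B" "card B \<le> 3" "bip_rows g ?S (?Z - ?S) \<subseteq> bit_fun.span B"
        using zs unfolding narrow_ordering_def cut_le_def by blast
      have C: "X - (Y \<union> ?S) = ?Z - ?S" by auto
      have "bip_rows g (Y \<union> ?S) (?Z - ?S) \<subseteq> insert 0 (bip_rows g ?S (?Z - ?S))"
        unfolding bip_rows_def using no by (auto simp: fun_eq_iff)
      also have "\<dots> \<subseteq> bit_fun.span B" using B(3) bit_fun.span_zero by (simp only: insert_subset simp_thms)
      finally show ?thesis unfolding S C cut_le_def using B(1,2) by blast
    qed
    then have "narrow_ordering X g (ys @ zs)"
      using ys zs Y(1) by (auto simp: narrow_ordering_def)
    then show ?thesis by blast
  qed
qed

section \<open>Pivot-minors\<close>

text \<open>\<open>V\<close> does not cut down the relation, so pivots translate by unconditional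
  equations; deletions restrict the relation explicitly.\<close>

definition graph_of :: "'a set \<Rightarrow> ('a \<Rightarrow> 'a \<Rightarrow> bool) \<Rightarrow> 'a pair_pre_digraph" where
  "graph_of V h = \<lparr>pverts = V, parcs = {(a, b). h a b}\<rparr>"

lemma graph_of_simps [simp]:
  "pverts (graph_of V h) = V" "(a, b) \<in> parcs (graph_of V h) \<longleftrightarrow> h a b"
  by (simp_all add: graph_of_def)

lemma local_complement_graph_of: "local_complement (graph_of V h) u = graph_of V (lc h u)"
  by (auto simp: local_complement_def graph_of_def lc_def nbrs_def Let_def)

lemma pivot_graph_of: "pivot (graph_of V h) u v = graph_of V (piv h u v)"
  by (simp add: pivot_def piv_def local_complement_graph_of)

lemma graph_of_parcs: "graph_of (pverts G) (\<lambda>a b. (a, b) \<in> parcs G) = G"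
  by (simp add: graph_of_def)

lemma pivot_minor_orb:
  assumes "orb V g h"
  shows "pivot_minor (graph_of V g) (graph_of V h)"
  using assms
proof (induction rule: orb.induct)
  case orb_refl
  show ?case by (rule pivot_minor.refl)
next
  case (orb_step h u v)
  have "(u, v) \<in> parcs (graph_of V h)" using orb_step by simp
  then show ?case using pivot_minor.pivot[OF orb_step.IH] by (simp add: pivot_graph_of)
qed

lemma pivot_minor_delete_vertices:
  assumes "pivot_minor G (graph_of V h)" "finite D" "D \<subseteq> V"
  shows "pivot_minor G (graph_of (V - D) (\<lambda>a b. h a b \<and> a \<notin> D \<and> b \<notin> D))"
  using assms(2,3)
proof (induction rule: finite_induct)
  case empty
  show ?case using assms(1) by simp
next
  case (insert x D)
  let ?H = "graph_of (V - D) (\<lambda>a b. h a b \<and> a \<notin> D \<and> b \<notin> D)"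
  have "pivot_minor G (delete_vertex ?H x)"
    using insert by (intro pivot_minor.delete) auto
  moreover have "delete_vertex ?H x =
      graph_of (V - insert x D) (\<lambda>a b. h a b \<and> a \<notin> insert x D \<and> b \<notin> insert x D)"
    by (auto simp: delete_vertex_def graph_of_def)
  ultimately show ?case by simp
qed

lemma claw_isoI:
  assumes "pair_graph (graph_of {a, b, c, d} k)" "distinct [a, b, c, d]"
    and "k a b" "k a c" "k a d" "\<not> k b c" "\<not> k b d" "\<not> k c d"
  shows "digraph_iso (with_proj (graph_of {a, b, c, d} k)) (with_proj claw)"
proof -
  let ?H = "graph_of {a, b, c, d} k"
  interpret H: pair_graph ?H by fact
  have k: "k x y \<Longrightarrow> x \<in> {a, b, c, d} \<and> y \<in> {a, b, c, d}" "k x y \<longleftrightarrow> k y x" "\<not> k x x" for x y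
    using H.in_arcsD1[of x y] H.in_arcsD2[of x y] H.arcs_symmetric[of x y] H.arcs_symmetric[of y x]
      H.no_loops'[of x x] by auto
  have arcs: "parcs ?H = {(a, b), (a, c), (a, d), (b, a), (c, a), (d, a)}"
  proof -
    have "k x y \<longleftrightarrow> (x, y) \<in> {(a, b), (a, c), (a, d), (b, a), (c, a), (d, a)}" for x y
      using k(1)[of x y] k(2)[of b a] k(2)[of c a] k(2)[of d a] k(2)[of c b] k(2)[of d b] k(2)[of d c]
        k(3)[of a] k(3)[of b] k(3)[of c] k(3)[of d] assms(3-8) by auto
    then show ?thesis by (auto simp: graph_of_def)
  qed
  define f where "f = (\<lambda>x. if x = a then 0 else if x = b then 1 else if x = c then 2 else (3 :: nat))"
  have f: "f a = 0" "f b = 1" "f c = 2" "f d = 3" using assms(2) by (auto simp: f_def)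
  let ?i = "\<lparr>iso_verts = f, iso_arcs = (\<lambda>(x, y). (f x, f y)), iso_head = snd, iso_tail = fst\<rparr>"
  have "inj_on f {a, b, c, d}" by (auto simp: inj_on_def f)
  moreover have "inj_on (\<lambda>(x, y). (f x, f y)) (parcs ?H)"
    unfolding arcs by (auto simp: inj_on_def f)
  moreover have "wf_digraph (with_proj ?H)" by unfold_locales
  ultimately have "pre_digraph.digraph_isomorphism (with_proj ?H) ?i"
    unfolding pre_digraph.digraph_isomorphism_def by auto
  moreover have "with_proj claw = app_iso ?i (with_proj ?H)"
    unfolding app_iso_def with_proj_def claw_def using arcs f by (auto simp: graph_of_def)
  ultimately show ?thesis unfolding digraph_iso_def by blast
qed

text \<open>All pivots are made on the full vertex set, and the vertices outside the four of the
  claw are deleted at the end.\<close>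

lemma orb_claw_free_if_pivot_minor_free:
  assumes "pair_graph G" "pivot_minor_free G claw"
  shows "orb_claw_free (pverts G) (\<lambda>a b. (a, b) \<in> parcs G)"
  unfolding orb_claw_free_def claw_free_def
proof (intro allI impI notI, elim bexE conjE)
  fix h a b c d
  let ?V = "pverts G"
  assume orb: "orb ?V (\<lambda>a b. (a, b) \<in> parcs G) h" and V: "a \<in> ?V" "b \<in> ?V" "c \<in> ?V" "d \<in> ?V"
    and ne: "distinct [b, c, d]" and h: "h a b" "h a c" "h a d" "\<not> h b c" "\<not> h b d" "\<not> h c d"
  interpret G: pair_graph G by fact
  let ?D = "?V - {a, b, c, d}"
  let ?k = "\<lambda>x y. h x y \<and> x \<notin> ?D \<and> y \<notin> ?D"
  have 1: "pivot_minor G (graph_of ?V h)"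
    using pivot_minor_orb[OF orb] by (simp only: graph_of_parcs)
  have "pivot_minor G (graph_of (?V - ?D) ?k)"
    by (rule pivot_minor_delete_vertices[OF 1]) auto
  moreover have "?V - ?D = {a, b, c, d}" using V by auto
  ultimately have pm: "pivot_minor G (graph_of {a, b, c, d} ?k)" by simp
  have "pair_graph (graph_of ?V h)" by (rule pair_graph_pivot_minor[OF 1 assms(1)])
  then interpret H: pair_graph "graph_of ?V h" .
  have "a \<noteq> b" "a \<noteq> c" "a \<noteq> d" using h H.no_loops' by auto
  then have "digraph_iso (with_proj (graph_of {a, b, c, d} ?k)) (with_proj claw)"
    using ne h by (intro claw_isoI[OF pair_graph_pivot_minor[OF pm assms(1)]]) auto
  then show False using assms(2) pm unfolding pivot_minor_free_def by blast
qed

lemma cutrk_le: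
  assumes "cut_le k (\<lambda>a b. (a, b) \<in> parcs G) S (pverts G - S)"
  shows "cutrk G S \<le> k"
proof -
  obtain B where B: "finite B" "card B \<le> k" "bip_rows (\<lambda>a b. (a, b) \<in> parcs G) S (pverts G - S) \<subseteq> bit_fun.span B"
    using assms unfolding cut_le_def by blast
  have "(\<lambda>r c. if c \<in> pverts G - S then adj_matrix G r c else 0) ` S =
      bip_rows (\<lambda>a b. (a, b) \<in> parcs G) S (pverts G - S)"
    unfolding bip_rows_def by (rule image_cong[OF HOL.refl]) (simp add: adj_matrix_def fun_eq_iff)
  then have "cutrk G S = bit_fun.dim (bip_rows (\<lambda>a b. (a, b) \<in> parcs G) S (pverts G - S))"
    by (simp only: cutrk_def bit_rank_def)
  also have "\<dots> \<le> card B" by (rule bit_fun.dim_le_card[OF B(3,1)])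
  finally show ?thesis using B(2) by simp
qed

theorem theorem1p8:
  fixes G :: "'a pair_pre_digraph"
  assumes "pair_graph G"
    and "pivot_minor_free G claw"
  shows "linear_rank_width G \<le> 59"
proof -
  interpret pair_graph G by fact
  have "sgraph (\<lambda>a b. (a, b) \<in> parcs G)"
    unfolding sgraph_def using arcs_symmetric no_loops' by blast
  then obtain xs where xs: "narrow_ordering (pverts G) (\<lambda>a b. (a, b) \<in> parcs G) xs"
    using narrow_ordering_exists[OF pair_finite_verts _ orb_claw_free_if_pivot_minor_free[OF assms]]
    by blast
  have "cutrk G (set (take i xs)) \<le> 3" for i
    by (rule cutrk_le) (use xs in \<open>simp add: narrow_ordering_def\<close>)
  then have "ordering_width G xs \<le> 3"
    unfolding ordering_width_def by (intro Max.boundedI) auto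
  moreover have "xs \<in> permutations_of_set (pverts G)"
    using xs by (simp add: narrow_ordering_def permutations_of_set_def)
  then have "linear_rank_width G \<le> ordering_width G xs"
    unfolding linear_rank_width_def by (intro Min_le) (simp_all add: finite_permutations_of_set)
  ultimately show ?thesis by simp
qed

end
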